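(* Both $(\mathcal{H}_{\mathbf{dqp}},m,\Delta)$ and $(\mathcal{H}_{\mathbf{dqp}},m,\Delta_<)$ are graded, connected Hopf algebras. Moreover, $\mathcal{H}_{\mathbf{sqp}}$, $\mathcal{H}_{\mathbf{dp}}$ and $\mathcal{H}_{\mathbf{tqp}}$ are Hopf subalgebras for both coproducts. Finally, the splitting map $pos$ (extended linearly) is a Hopf algebra morphism and a projection from $(\mathcal{H}_{\mathbf{dqp}},m,\Delta_<)$ to $(\mathcal{H}_{\mathbf{dp}},m,\Delta)$.
   Context: Fix an arbitrary field $K$. A preorder is a reflexive transitive relation; an order is an antisymmetric preorder. For a preorder $\leq_a$, write $i\sim_a j$ if $i\leq_a j$ and $j\leq_a i$, and $i<_a j$ if $i\leq_a j$ and not $i\sim_a j$. A double quasi-poset is a triple $P=(V(P),\leq_1,\leq_2)$ with $V(P)$ a finite set and $\leq_1,\leq_2$ two preorders on $V(P)$. An isomorphism $P\to Q$ is a bijection $V(P)\to V(Q)$ preserving and reflecting both preorders. $\mathbf{dqp}$ is the set of isomorphism classes of double quasi-posets, and $\mathcal{H}_{\mathbf{dqp}}$ is the $K$-vector space with basis $\mathbf{dqp}$, graded by the cardinality of $V(P)$. $P$ is special if $\leq_2$ is a total preorder; trivial if distinct elements are never comparable for $\leq_1$; a double poset if both $\leq_1$ and $\leq_2$ are (partial) orders. $\mathcal{H}_{\mathbf{sqp}}$, $\mathcal{H}_{\mathbf{tqp}}$, $\mathcal{H}_{\mathbf{dp}}$ are the subspaces of $\mathcal{H}_{\mathbf{dqp}}$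 spanned by the classes of special double quasi-posets, trivial double quasi-posets, and double posets respectively. Product $m$: $PQ$ has underlying set $V(P)\sqcup V(Q)$; $i\leq_1 j$ in $PQ$ iff $i,j$ both lie in $V(P)$ and $i\leq_1 j$ in $P$, or both lie in $V(Q)$ and $i\leq_1 j$ in $Q$; $i\leq_2 j$ in $PQ$ iff ($i,j\in V(P)$ and $i\leq_2 j$ in $P$) or ($i,j\in V(Q)$ and $i\leq_2 j$ in $Q$) or ($i\in V(P)$ and $j\in V(Q)$). It is extended bilinearly; the unit is the empty double quasi-poset $1$. For $X\subseteq V(P)$, $P_{\mid X}$ is the restriction of $P$ to $X$. $X$ is open ($X\in Top(P)$) if $i\in X$ and $i\leq_1 j$ imply $j\in X$; $X$ is preopen ($X\in Top_<(P)$) if $i\in X$ and $i<_1 j$ imply $j\in X$. The coproducts are $$\Delta(P)=\sum_{O\in Top(P)}P_{\mid V(P)\setminus O}\otimes P_{\mid O},\qquad \Delta_<(P)=\sum_{O\in Top_<(P)}P_{\mid V(P)\setminus O}\otimes P_{\mid O}.$$ The splitting of $P$ is the double poset $pos(P)=(V(P),\preceq_1,\preceq_2)$ where, for $a=1,2$, $i\preceq_a j$ iff $i<_a j$ or $i=j$. *)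

theory Defs
  imports Complex_Main "HOL-Library.Poly_Mapping" "HOL-Library.Nat_Bijection"
begin

section \<open>Vector spaces with a basis\<close>

text \<open>
  The type \<^typ>\<open>'b \<Rightarrow>\<^sub>0 'k\<close> (finitely supported functions) is the vector space over the
  field \<^typ>\<open>'k\<close> with basis \<^typ>\<open>'b\<close>.  The tensor product of the spaces with bases
  \<^typ>\<open>'b\<close> and \<^typ>\<open>'c\<close> is the space with basis \<^typ>\<open>'b \<times> 'c\<close>,
  the pair \<open>(a, b)\<close> standing for \<open>a \<otimes> b\<close>.  The multiplication that the library puts on
  \<^typ>\<open>'b \<Rightarrow>\<^sub>0 'k\<close> is not used.
\<close>

definition vscale :: "'k::field \<Rightarrow> ('b \<Rightarrow>\<^sub>0 'k) \<Rightarrow> ('b \<Rightarrow>\<^sub>0 'k)" where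
  "vscale c = Poly_Mapping.map ((*) c)"

lemma lookup_vscale: "Poly_Mapping.lookup (vscale c p) b = c * Poly_Mapping.lookup p b"
  by (cases "Poly_Mapping.lookup p b = 0") (simp_all add: vscale_def Poly_Mapping.map.rep_eq)

global_interpretation vs: vector_space vscale
  by unfold_locales (auto intro!: poly_mapping_eqI simp: lookup_vscale lookup_add algebra_simps)

abbreviation basis_vec :: "'b \<Rightarrow> ('b \<Rightarrow>\<^sub>0 'k::field)" where
  "basis_vec b \<equiv> Poly_Mapping.single b 1"

abbreviation linear_map :: "(('b \<Rightarrow>\<^sub>0 'k::field) \<Rightarrow> ('c \<Rightarrow>\<^sub>0 'k)) \<Rightarrow> bool" where
  "linear_map \<equiv> Vector_Spaces.linear vscale vscale"

abbreviation linear_form :: "(('b \<Rightarrow>\<^sub>0 'k::field) \<Rightarrow> 'k) \<Rightarrow> bool" where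
  "linear_form \<equiv> Vector_Spaces.linear vscale (*)"

definition lin_ext :: "('b \<Rightarrow> ('c \<Rightarrow>\<^sub>0 'k::field)) \<Rightarrow> ('b \<Rightarrow>\<^sub>0 'k) \<Rightarrow> ('c \<Rightarrow>\<^sub>0 'k)" where
  "lin_ext f p = (\<Sum>b\<in>Poly_Mapping.keys p. vscale (Poly_Mapping.lookup p b) (f b))"

definition bilin_ext ::
  "('a \<Rightarrow> 'b \<Rightarrow> ('c \<Rightarrow>\<^sub>0 'k::field)) \<Rightarrow> ('a \<Rightarrow>\<^sub>0 'k) \<Rightarrow> ('b \<Rightarrow>\<^sub>0 'k) \<Rightarrow> ('c \<Rightarrow>\<^sub>0 'k)" where
  "bilin_ext f p q = lin_ext (\<lambda>a. lin_ext (f a) q) p"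

definition tensor :: "('a \<Rightarrow>\<^sub>0 'k::field) \<Rightarrow> ('b \<Rightarrow>\<^sub>0 'k) \<Rightarrow> ('a \<times> 'b \<Rightarrow>\<^sub>0 'k)" where
  "tensor = bilin_ext (\<lambda>a b. basis_vec (a, b))"

definition tensor_map ::
  "(('a \<Rightarrow>\<^sub>0 'k::field) \<Rightarrow> ('c \<Rightarrow>\<^sub>0 'k)) \<Rightarrow> (('b \<Rightarrow>\<^sub>0 'k) \<Rightarrow> ('d \<Rightarrow>\<^sub>0 'k))
    \<Rightarrow> ('a \<times> 'b \<Rightarrow>\<^sub>0 'k) \<Rightarrow> ('c \<times> 'd \<Rightarrow>\<^sub>0 'k)" where
  "tensor_map f g = lin_ext (\<lambda>(a, b). tensor (f (basis_vec a)) (g (basis_vec b)))"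

text \<open>The image of \<open>A \<otimes> B\<close> in the tensor product of the ambient spaces, for subspaces \<open>A\<close> and \<open>B\<close>.\<close>

definition tensor_subspace ::
  "('a \<Rightarrow>\<^sub>0 'k::field) set \<Rightarrow> ('b \<Rightarrow>\<^sub>0 'k) set \<Rightarrow> ('a \<times> 'b \<Rightarrow>\<^sub>0 'k) set" where
  "tensor_subspace A B = vs.span {tensor x y | x y. x \<in> A \<and> y \<in> B}"

definition tensor_assoc :: "(('a \<times> 'b) \<times> 'c \<Rightarrow>\<^sub>0 'k::field) \<Rightarrow> ('a \<times> ('b \<times> 'c) \<Rightarrow>\<^sub>0 'k)" where
  "tensor_assoc = lin_ext (\<lambda>((a, b), c). basis_vec (a, (b, c)))"

text \<open>
  For a linear form \<open>\<epsilon>\<close>, the maps \<open>\<epsilon> \<otimes> id\<close> and \<open>id \<otimes> \<epsilon>\<close> with \<open>K \<otimes> V\<close> and \<open>V \<otimes> K\<close>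
  identified with \<open>V\<close>.
\<close>

definition contract_left :: "(('a \<Rightarrow>\<^sub>0 'k::field) \<Rightarrow> 'k) \<Rightarrow> ('a \<times> 'b \<Rightarrow>\<^sub>0 'k) \<Rightarrow> ('b \<Rightarrow>\<^sub>0 'k)" where
  "contract_left \<epsilon> = lin_ext (\<lambda>(a, b). vscale (\<epsilon> (basis_vec a)) (basis_vec b))"

definition contract_right :: "(('b \<Rightarrow>\<^sub>0 'k::field) \<Rightarrow> 'k) \<Rightarrow> ('a \<times> 'b \<Rightarrow>\<^sub>0 'k) \<Rightarrow> ('a \<Rightarrow>\<^sub>0 'k)" where
  "contract_right \<epsilon> = lin_ext (\<lambda>(a, b). vscale (\<epsilon> (basis_vec b)) (basis_vec a))"

definition mult_lin ::
  "(('b \<Rightarrow>\<^sub>0 'k::field) \<Rightarrow> ('b \<Rightarrow>\<^sub>0 'k) \<Rightarrow> ('b \<Rightarrow>\<^sub>0 'k)) \<Rightarrow> ('b \<times> 'b \<Rightarrow>\<^sub>0 'k) \<Rightarrow> ('b \<Rightarrow>\<^sub>0 'k)" where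
  "mult_lin m = lin_ext (\<lambda>(a, b). m (basis_vec a) (basis_vec b))"

text \<open>The product \<open>(a \<otimes> b)(c \<otimes> d) = ac \<otimes> bd\<close> of the tensor square.\<close>

definition tensor_mult ::
  "(('b \<Rightarrow>\<^sub>0 'k::field) \<Rightarrow> ('b \<Rightarrow>\<^sub>0 'k) \<Rightarrow> ('b \<Rightarrow>\<^sub>0 'k))
    \<Rightarrow> ('b \<times> 'b \<Rightarrow>\<^sub>0 'k) \<Rightarrow> ('b \<times> 'b \<Rightarrow>\<^sub>0 'k) \<Rightarrow> ('b \<times> 'b \<Rightarrow>\<^sub>0 'k)" where
  "tensor_mult m = bilin_ext (\<lambda>(a, b) (c, d).
     tensor (m (basis_vec a) (basis_vec c)) (m (basis_vec b) (basis_vec d)))"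


section \<open>Hopf algebras\<close>

locale unital_algebra =
  fixes m :: "('b \<Rightarrow>\<^sub>0 'k::field) \<Rightarrow> ('b \<Rightarrow>\<^sub>0 'k) \<Rightarrow> ('b \<Rightarrow>\<^sub>0 'k)"
    and u :: "'b \<Rightarrow>\<^sub>0 'k"
  assumes mult_linear_right: "linear_map (m x)"
    and mult_linear_left: "linear_map (\<lambda>x. m x y)"
    and mult_assoc: "m (m x y) z = m x (m y z)"
    and mult_unit_left: "m u x = x"
    and mult_unit_right: "m x u = x"

locale counital_coalgebra =
  fixes \<Delta> :: "('b \<Rightarrow>\<^sub>0 'k::field) \<Rightarrow> ('b \<times> 'b \<Rightarrow>\<^sub>0 'k)"
    and \<epsilon> :: "('b \<Rightarrow>\<^sub>0 'k) \<Rightarrow> 'k"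
  assumes comult_linear: "linear_map \<Delta>"
    and counit_linear: "linear_form \<epsilon>"
    and coassoc: "tensor_assoc (tensor_map \<Delta> id (\<Delta> x)) = tensor_map id \<Delta> (\<Delta> x)"
    and counit_left: "contract_left \<epsilon> (\<Delta> x) = x"
    and counit_right: "contract_right \<epsilon> (\<Delta> x) = x"

locale bialgebra = unital_algebra m u + counital_coalgebra \<Delta> \<epsilon>
  for m :: "('b \<Rightarrow>\<^sub>0 'k::field) \<Rightarrow> ('b \<Rightarrow>\<^sub>0 'k) \<Rightarrow> ('b \<Rightarrow>\<^sub>0 'k)" and u \<Delta> \<epsilon> +
  assumes comult_mult: "\<Delta> (m x y) = tensor_mult m (\<Delta> x) (\<Delta> y)"
    and comult_unit: "\<Delta> u = tensor u u"
    and counit_mult: "\<epsilon> (m x y) = \<epsilon> x * \<epsilon> y"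
    and counit_unit: "\<epsilon> u = 1"

definition is_antipode ::
  "(('b \<Rightarrow>\<^sub>0 'k::field) \<Rightarrow> ('b \<Rightarrow>\<^sub>0 'k) \<Rightarrow> ('b \<Rightarrow>\<^sub>0 'k)) \<Rightarrow> ('b \<Rightarrow>\<^sub>0 'k)
    \<Rightarrow> (('b \<Rightarrow>\<^sub>0 'k) \<Rightarrow> ('b \<times> 'b \<Rightarrow>\<^sub>0 'k)) \<Rightarrow> (('b \<Rightarrow>\<^sub>0 'k) \<Rightarrow> 'k)
    \<Rightarrow> (('b \<Rightarrow>\<^sub>0 'k) \<Rightarrow> ('b \<Rightarrow>\<^sub>0 'k)) \<Rightarrow> bool" where
  "is_antipode m u \<Delta> \<epsilon> S \<longleftrightarrow> linear_map S \<and>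
     (\<forall>x. mult_lin m (tensor_map S id (\<Delta> x)) = vscale (\<epsilon> x) u) \<and>
     (\<forall>x. mult_lin m (tensor_map id S (\<Delta> x)) = vscale (\<epsilon> x) u)"

locale hopf_algebra = bialgebra m u \<Delta> \<epsilon>
  for m :: "('b \<Rightarrow>\<^sub>0 'k::field) \<Rightarrow> ('b \<Rightarrow>\<^sub>0 'k) \<Rightarrow> ('b \<Rightarrow>\<^sub>0 'k)" and u \<Delta> \<epsilon> +
  assumes antipode_exists: "\<exists>S. is_antipode m u \<Delta> \<epsilon> S"

text \<open>\<open>G\<close> is a direct sum decomposition of the whole space into subspaces.\<close>

definition vector_space_grading :: "(nat \<Rightarrow> ('b \<Rightarrow>\<^sub>0 'k::field) set) \<Rightarrow> bool" where
  "vector_space_grading G \<longleftrightarrow> (\<forall>n. vs.subspace (G n)) \<and>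
     (\<forall>x. \<exists>!c. finite {n. c n \<noteq> 0} \<and> (\<forall>n. c n \<in> G n) \<and> x = (\<Sum>n | c n \<noteq> 0. c n))"

locale graded_hopf_algebra = hopf_algebra m u \<Delta> \<epsilon>
  for m :: "('b \<Rightarrow>\<^sub>0 'k::field) \<Rightarrow> ('b \<Rightarrow>\<^sub>0 'k) \<Rightarrow> ('b \<Rightarrow>\<^sub>0 'k)" and u \<Delta> \<epsilon> +
  fixes G :: "nat \<Rightarrow> ('b \<Rightarrow>\<^sub>0 'k) set"
  assumes grading: "vector_space_grading G"
    and graded_mult: "\<lbrakk>x \<in> G i; y \<in> G j\<rbrakk> \<Longrightarrow> m x y \<in> G (i + j)"
    and graded_unit: "u \<in> G 0"
    and graded_comult:
      "x \<in> G n \<Longrightarrow> \<Delta> x \<in> vs.span (\<Union>i\<le>n. tensor_subspace (G i) (G (n - i)))"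
    and graded_counit: "\<lbrakk>x \<in> G n; n \<noteq> 0\<rbrakk> \<Longrightarrow> \<epsilon> x = 0"
    and graded_antipode: "\<lbrakk>is_antipode m u \<Delta> \<epsilon> S; x \<in> G n\<rbrakk> \<Longrightarrow> S x \<in> G n"

locale graded_connected_hopf_algebra = graded_hopf_algebra m u \<Delta> \<epsilon> G
  for m :: "('b \<Rightarrow>\<^sub>0 'k::field) \<Rightarrow> ('b \<Rightarrow>\<^sub>0 'k) \<Rightarrow> ('b \<Rightarrow>\<^sub>0 'k)" and u \<Delta> \<epsilon> G +
  assumes connected: "vs.dim (G 0) = 1"

definition hopf_subalgebra ::
  "(('b \<Rightarrow>\<^sub>0 'k::field) \<Rightarrow> ('b \<Rightarrow>\<^sub>0 'k) \<Rightarrow> ('b \<Rightarrow>\<^sub>0 'k)) \<Rightarrow> ('b \<Rightarrow>\<^sub>0 'k)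
    \<Rightarrow> (('b \<Rightarrow>\<^sub>0 'k) \<Rightarrow> ('b \<times> 'b \<Rightarrow>\<^sub>0 'k)) \<Rightarrow> (('b \<Rightarrow>\<^sub>0 'k) \<Rightarrow> 'k)
    \<Rightarrow> ('b \<Rightarrow>\<^sub>0 'k) set \<Rightarrow> bool" where
  "hopf_subalgebra m u \<Delta> \<epsilon> B \<longleftrightarrow> hopf_algebra m u \<Delta> \<epsilon> \<and> vs.subspace B \<and>
     u \<in> B \<and> (\<forall>x\<in>B. \<forall>y\<in>B. m x y \<in> B) \<and>
     (\<forall>x\<in>B. \<Delta> x \<in> tensor_subspace B B) \<and>
     (\<exists>S. is_antipode m u \<Delta> \<epsilon> S \<and> (\<forall>x\<in>B. S x \<in> B))"

text \<open>
  Morphisms from a Hopf algebra to a Hopf subalgebra \<open>B\<close> of a Hopf algebra; the structure of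
  \<open>B\<close> is the restriction of the ambient one.
\<close>

definition hopf_morphism_into ::
  "(('b \<Rightarrow>\<^sub>0 'k::field) \<Rightarrow> ('b \<Rightarrow>\<^sub>0 'k) \<Rightarrow> ('b \<Rightarrow>\<^sub>0 'k)) \<Rightarrow> ('b \<Rightarrow>\<^sub>0 'k)
    \<Rightarrow> (('b \<Rightarrow>\<^sub>0 'k) \<Rightarrow> ('b \<times> 'b \<Rightarrow>\<^sub>0 'k)) \<Rightarrow> (('b \<Rightarrow>\<^sub>0 'k) \<Rightarrow> 'k)
    \<Rightarrow> (('c \<Rightarrow>\<^sub>0 'k) \<Rightarrow> ('c \<Rightarrow>\<^sub>0 'k) \<Rightarrow> ('c \<Rightarrow>\<^sub>0 'k)) \<Rightarrow> ('c \<Rightarrow>\<^sub>0 'k)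
    \<Rightarrow> (('c \<Rightarrow>\<^sub>0 'k) \<Rightarrow> ('c \<times> 'c \<Rightarrow>\<^sub>0 'k)) \<Rightarrow> (('c \<Rightarrow>\<^sub>0 'k) \<Rightarrow> 'k)
    \<Rightarrow> ('c \<Rightarrow>\<^sub>0 'k) set \<Rightarrow> (('b \<Rightarrow>\<^sub>0 'k) \<Rightarrow> ('c \<Rightarrow>\<^sub>0 'k)) \<Rightarrow> bool" where
  "hopf_morphism_into m u \<Delta> \<epsilon> m' u' \<Delta>' \<epsilon>' B f \<longleftrightarrow>
     hopf_algebra m u \<Delta> \<epsilon> \<and> hopf_subalgebra m' u' \<Delta>' \<epsilon>' B \<and>
     linear_map f \<and> (\<forall>x. f x \<in> B) \<and>
     (\<forall>x y. f (m x y) = m' (f x) (f y)) \<and> f u = u' \<and>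
     (\<forall>x. \<Delta>' (f x) = tensor_map f f (\<Delta> x)) \<and> (\<forall>x. \<epsilon>' (f x) = \<epsilon> x) \<and>
     (\<exists>S S'. is_antipode m u \<Delta> \<epsilon> S \<and> is_antipode m' u' \<Delta>' \<epsilon>' S' \<and> (\<forall>x. f (S x) = S' (f x)))"


section \<open>Double quasi-posets\<close>

record 'a dqs =
  verts :: "'a set"
  le1 :: "'a rel"
  le2 :: "'a rel"

definition double_quasi_poset :: "'a dqs \<Rightarrow> bool" where
  "double_quasi_poset P \<longleftrightarrow>
     finite (verts P) \<and> preorder_on (verts P) (le1 P) \<and> preorder_on (verts P) (le2 P)"

definition strict_part :: "'a rel \<Rightarrow> 'a rel" where
  "strict_part r = {(i, j). (i, j) \<in> r \<and> \<not> ((i, j) \<in> r \<and> (j, i) \<in> r)}"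

definition dqs_iso :: "'a dqs \<Rightarrow> 'b dqs \<Rightarrow> ('a \<Rightarrow> 'b) \<Rightarrow> bool" where
  "dqs_iso P Q f \<longleftrightarrow> bij_betw f (verts P) (verts Q) \<and>
     (\<forall>i\<in>verts P. \<forall>j\<in>verts P. (i, j) \<in> le1 P \<longleftrightarrow> (f i, f j) \<in> le1 Q) \<and>
     (\<forall>i\<in>verts P. \<forall>j\<in>verts P. (i, j) \<in> le2 P \<longleftrightarrow> (f i, f j) \<in> le2 Q)"

definition dqs_equiv :: "'a dqs \<Rightarrow> 'a dqs \<Rightarrow> bool" where
  "dqs_equiv P Q \<longleftrightarrow> double_quasi_poset P \<and> double_quasi_poset Q \<and> (\<exists>f. dqs_iso P Q f)"

definition dqs_empty :: "'a dqs" where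
  "dqs_empty = \<lparr>verts = {}, le1 = {}, le2 = {}\<rparr>"

definition dqs_restrict :: "'a dqs \<Rightarrow> 'a set \<Rightarrow> 'a dqs" where
  "dqs_restrict P X = \<lparr>verts = verts P \<inter> X, le1 = le1 P \<inter> X \<times> X, le2 = le2 P \<inter> X \<times> X\<rparr>"

definition dqs_image :: "('a \<Rightarrow> 'b) \<Rightarrow> 'a dqs \<Rightarrow> 'b dqs" where
  "dqs_image f P = \<lparr>verts = f ` verts P, le1 = map_prod f f ` le1 P, le2 = map_prod f f ` le2 P\<rparr>"

definition dqs_prod :: "'a dqs \<Rightarrow> 'b dqs \<Rightarrow> ('a + 'b) dqs" where
  "dqs_prod P Q =
    \<lparr>verts = verts P <+> verts Q,
     le1 = map_prod Inl Inl ` le1 P \<union> map_prod Inr Inr ` le1 Q,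
     le2 = map_prod Inl Inl ` le2 P \<union> map_prod Inr Inr ` le2 Q
           \<union> (Inl ` verts P) \<times> (Inr ` verts Q)\<rparr>"

definition opens :: "'a dqs \<Rightarrow> 'a set set" where
  "opens P = {X. X \<subseteq> verts P \<and> (\<forall>i j. i \<in> X \<and> (i, j) \<in> le1 P \<longrightarrow> j \<in> X)}"

definition preopens :: "'a dqs \<Rightarrow> 'a set set" where
  "preopens P = {X. X \<subseteq> verts P \<and> (\<forall>i j. i \<in> X \<and> (i, j) \<in> strict_part (le1 P) \<longrightarrow> j \<in> X)}"

definition dqs_special :: "'a dqs \<Rightarrow> bool" where
  "dqs_special P \<longleftrightarrow> total_on (verts P) (le2 P)"

definition dqs_trivial :: "'a dqs \<Rightarrow> bool" where
  "dqs_trivial P \<longleftrightarrow> (\<forall>i\<in>verts P. \<forall>j\<in>verts P. i \<noteq> j \<longrightarrow> (i, j) \<notin> le1 P)"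

definition dqs_double_poset :: "'a dqs \<Rightarrow> bool" where
  "dqs_double_poset P \<longleftrightarrow> partial_order_on (verts P) (le1 P) \<and> partial_order_on (verts P) (le2 P)"

definition dqs_pos :: "'a dqs \<Rightarrow> 'a dqs" where
  "dqs_pos P = \<lparr>verts = verts P,
     le1 = strict_part (le1 P) \<union> Id_on (verts P), le2 = strict_part (le2 P) \<union> Id_on (verts P)\<rparr>"


subsection \<open>Compatibility with isomorphism\<close>

lemma dqs_iso_sym:
  assumes "dqs_iso P Q f"
  shows "dqs_iso Q P (inv_into (verts P) f)"
proof -
  let ?g = "inv_into (verts P) f"
  from assms have b: "bij_betw f (verts P) (verts Q)" by (simp add: dqs_iso_def)
  have g: "?g i \<in> verts P" "f (?g i) = i" if "i \<in> verts Q" for i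
    using b that by (auto simp: bij_betw_def inv_into_into f_inv_into_f)
  show ?thesis
    using assms bij_betw_inv_into[OF b] g by (simp add: dqs_iso_def)
qed

lemma dqs_iso_trans:
  assumes "dqs_iso P Q f" "dqs_iso Q R g"
  shows "dqs_iso P R (g \<circ> f)"
  using assms by (auto simp: dqs_iso_def intro: bij_betw_trans dest: bij_betwE)

lemma dqs_equiv_part_equivp: "part_equivp (dqs_equiv :: 'a dqs \<Rightarrow> 'a dqs \<Rightarrow> bool)"
proof (rule part_equivpI)
  have "dqs_equiv (dqs_empty :: 'a dqs) dqs_empty"
    by (auto simp: dqs_equiv_def dqs_empty_def double_quasi_poset_def dqs_iso_def)
  then show "\<exists>P :: 'a dqs. dqs_equiv P P" by blast
  show "symp (dqs_equiv :: 'a dqs \<Rightarrow> 'a dqs \<Rightarrow> bool)"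
    unfolding symp_def dqs_equiv_def by (blast intro: dqs_iso_sym)
  show "transp (dqs_equiv :: 'a dqs \<Rightarrow> 'a dqs \<Rightarrow> bool)"
    unfolding transp_def dqs_equiv_def by (blast intro: dqs_iso_trans)
qed

lemma preorder_on_restrict:
  assumes "preorder_on A r"
  shows "preorder_on (A \<inter> X) (r \<inter> X \<times> X)"
proof -
  have "trans (r \<inter> X \<times> X)"
    using assms unfolding preorder_on_def trans_def by blast
  then show ?thesis using assms by (auto simp: preorder_on_def refl_on_def)
qed

lemma double_quasi_poset_restrict:
  "double_quasi_poset P \<Longrightarrow> double_quasi_poset (dqs_restrict P X)"
  by (simp add: double_quasi_poset_def dqs_restrict_def preorder_on_restrict)

lemma dqs_iso_restrict:
  assumes "dqs_iso P Q f" "X \<subseteq> verts P"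
  shows "dqs_iso (dqs_restrict P X) (dqs_restrict Q (f ` X)) f"
proof -
  have b: "bij_betw f (verts P) (verts Q)" using assms by (simp add: dqs_iso_def)
  have "bij_betw f X (f ` X)" using b assms(2) by (meson bij_betw_subset)
  moreover have "verts P \<inter> X = X" using assms by auto
  moreover have "verts Q \<inter> f ` X = f ` X" using b assms(2) by (auto simp: bij_betw_def)
  ultimately show ?thesis using assms
    by (auto simp: dqs_iso_def dqs_restrict_def subset_iff)
qed

lemma preorder_on_image:
  assumes "preorder_on A r" "inj f"
  shows "preorder_on (f ` A) (map_prod f f ` r)"
proof -
  have "trans (map_prod f f ` r)"
  proof (rule transI)
    fix x y z assume "(x, y) \<in> map_prod f f ` r" "(y, z) \<in> map_prod f f ` r"
    then obtain a b c where "(a, b) \<in> r" "(b, c) \<in> r" "x = f a" "z = f c"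
      using assms(2) by (auto simp: inj_eq)
    moreover from this have "(a, c) \<in> r"
      using assms(1) unfolding preorder_on_def by (meson transD)
    ultimately show "(x, z) \<in> map_prod f f ` r" by force
  qed
  then show ?thesis using assms by (auto simp: preorder_on_def refl_on_def)
qed

lemma double_quasi_poset_image:
  "\<lbrakk>double_quasi_poset P; inj f\<rbrakk> \<Longrightarrow> double_quasi_poset (dqs_image f P)"
  by (simp add: double_quasi_poset_def dqs_image_def preorder_on_image)

lemma dqs_iso_image:
  assumes "inj f"
  shows "dqs_iso P (dqs_image f P) f"
  using assms
  by (auto simp: dqs_iso_def dqs_image_def inj_eq intro: inj_on_imp_bij_betw inj_on_subset)

lemma dqs_prod_simps [simp]:
  "Inl i \<in> verts (dqs_prod P Q) \<longleftrightarrow> i \<in> verts P"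
  "Inr j \<in> verts (dqs_prod P Q) \<longleftrightarrow> j \<in> verts Q"
  "(Inl i, Inl i') \<in> le1 (dqs_prod P Q) \<longleftrightarrow> (i, i') \<in> le1 P"
  "(Inr j, Inr j') \<in> le1 (dqs_prod P Q) \<longleftrightarrow> (j, j') \<in> le1 Q"
  "(Inl i, Inr j) \<notin> le1 (dqs_prod P Q)"
  "(Inr j, Inl i) \<notin> le1 (dqs_prod P Q)"
  "(Inl i, Inl i') \<in> le2 (dqs_prod P Q) \<longleftrightarrow> (i, i') \<in> le2 P"
  "(Inr j, Inr j') \<in> le2 (dqs_prod P Q) \<longleftrightarrow> (j, j') \<in> le2 Q"
  "(Inl i, Inr j) \<in> le2 (dqs_prod P Q) \<longleftrightarrow> i \<in> verts P \<and> j \<in> verts Q"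
  "(Inr j, Inl i) \<notin> le2 (dqs_prod P Q)"
  by (auto simp: dqs_prod_def)

lemma double_quasi_poset_prod:
  assumes P: "double_quasi_poset P" and Q: "double_quasi_poset Q"
  shows "double_quasi_poset (dqs_prod P Q)"
proof -
  have V: "le1 P \<subseteq> verts P \<times> verts P" "le2 P \<subseteq> verts P \<times> verts P"
    "le1 Q \<subseteq> verts Q \<times> verts Q" "le2 Q \<subseteq> verts Q \<times> verts Q"
    using P Q by (simp_all add: double_quasi_poset_def preorder_on_def)
  have t: "trans (le1 P)" "trans (le2 P)" "trans (le1 Q)" "trans (le2 Q)"
    using P Q by (simp_all add: double_quasi_poset_def preorder_on_def)
  have "(x, z) \<in> le1 (dqs_prod P Q)"
    if "(x, y) \<in> le1 (dqs_prod P Q)" "(y, z) \<in> le1 (dqs_prod P Q)" for x y z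
    using that by (cases x; cases y; cases z) 
      (simp_all, (erule (1) transD[OF t(1)] transD[OF t(3)])+)
  then have t1: "trans (le1 (dqs_prod P Q))" by (rule transI)
  have "(x, z) \<in> le2 (dqs_prod P Q)"
    if "(x, y) \<in> le2 (dqs_prod P Q)" "(y, z) \<in> le2 (dqs_prod P Q)" for x y z
    using that V by (cases x; cases y; cases z) 
      (simp_all, (erule (1) transD[OF t(2)] transD[OF t(4)] | blast)+)
  then have t2: "trans (le2 (dqs_prod P Q))" by (rule transI)
  have s: "le1 (dqs_prod P Q) \<subseteq> verts (dqs_prod P Q) \<times> verts (dqs_prod P Q)"
    "le2 (dqs_prod P Q) \<subseteq> verts (dqs_prod P Q) \<times> verts (dqs_prod P Q)"
    using V unfolding dqs_prod_def by auto
  have r: "(x, x) \<in> le1 (dqs_prod P Q) \<and> (x, x) \<in> le2 (dqs_prod P Q)"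
    if "x \<in> verts (dqs_prod P Q)" for x
    using that P Q by (cases x) (auto simp: double_quasi_poset_def preorder_on_def refl_on_def)
  have "finite (verts (dqs_prod P Q))"
    using P Q by (simp add: double_quasi_poset_def dqs_prod_def)
  with t1 t2 s r show ?thesis
    by (simp add: double_quasi_poset_def preorder_on_def refl_on_def)
qed

lemma dqs_iso_prod:
  assumes "dqs_iso P P' f" "dqs_iso Q Q' g"
  shows "dqs_iso (dqs_prod P Q) (dqs_prod P' Q') (map_sum f g)"
proof -
  have f: "bij_betw f (verts P) (verts P')" and g: "bij_betw g (verts Q) (verts Q')"
    using assms by (auto simp: dqs_iso_def)
  have b: "bij_betw (map_sum f g) (verts (dqs_prod P Q)) (verts (dqs_prod P' Q'))"
  proof (rule bij_betw_imageI)
    show "inj_on (map_sum f g) (verts (dqs_prod P Q))"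
    proof (rule inj_onI)
      fix x y
      assume "x \<in> verts (dqs_prod P Q)" "y \<in> verts (dqs_prod P Q)" "map_sum f g x = map_sum f g y"
      then show "x = y"
        using inj_onD[OF bij_betw_imp_inj_on[OF f]] inj_onD[OF bij_betw_imp_inj_on[OF g]]
        by (cases x; cases y) simp_all
    qed
    show "map_sum f g ` verts (dqs_prod P Q) = verts (dqs_prod P' Q')"
      using f g by (simp add: dqs_prod_def bij_betw_def Plus_def image_Un image_image
          flip: bij_betw_imp_surj_on[OF f] bij_betw_imp_surj_on[OF g])
  qed
  have r: "((x, y) \<in> le1 (dqs_prod P Q)
        \<longleftrightarrow> (map_sum f g x, map_sum f g y) \<in> le1 (dqs_prod P' Q')) \<and>
      ((x, y) \<in> le2 (dqs_prod P Q)
        \<longleftrightarrow> (map_sum f g x, map_sum f g y) \<in> le2 (dqs_prod P' Q'))"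
    if "x \<in> verts (dqs_prod P Q)" "y \<in> verts (dqs_prod P Q)" for x y
    using that assms bij_betwE[OF f] bij_betwE[OF g]
    by (cases x; cases y) (simp_all add: dqs_iso_def)
  show ?thesis unfolding dqs_iso_def by (intro conjI ballI b r[THEN conjunct1] r[THEN conjunct2])
qed

lemma dqs_iso_strict_part:
  assumes "dqs_iso P Q f" "i \<in> verts P" "j \<in> verts P"
  shows "(i, j) \<in> strict_part (le1 P) \<longleftrightarrow> (f i, f j) \<in> strict_part (le1 Q)"
    and "(i, j) \<in> strict_part (le2 P) \<longleftrightarrow> (f i, f j) \<in> strict_part (le2 Q)"
  using assms by (auto simp: dqs_iso_def strict_part_def)

lemma preorder_on_pos:
  "preorder_on A r \<Longrightarrow> preorder_on A (strict_part r \<union> Id_on A)"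
proof -
  assume r: "preorder_on A r"
  then have t: "\<And>x y z. \<lbrakk>(x, y) \<in> r; (y, z) \<in> r\<rbrakk> \<Longrightarrow> (x, z) \<in> r"
    by (meson preorder_on_def transD)
  have "trans (strict_part r \<union> Id_on A)"
  proof (rule transI)
    fix x y z
    assume "(x, y) \<in> strict_part r \<union> Id_on A" "(y, z) \<in> strict_part r \<union> Id_on A"
    then consider "(x, z) \<in> strict_part r \<union> Id_on A"
      | "(x, y) \<in> strict_part r" "(y, z) \<in> strict_part r" by blast
    then show "(x, z) \<in> strict_part r \<union> Id_on A"
    proof cases
      case 2
      then have "(x, z) \<in> r" "(z, x) \<notin> r"
        using t[of x y z] t[of y z x] by (auto simp: strict_part_def)
      then show ?thesis by (simp add: strict_part_def)
    qed
  qed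
  with r show ?thesis by (auto simp: preorder_on_def refl_on_def strict_part_def)
qed

lemma double_quasi_poset_pos: "double_quasi_poset P \<Longrightarrow> double_quasi_poset (dqs_pos P)"
  by (auto simp: double_quasi_poset_def dqs_pos_def intro: preorder_on_pos)

lemma dqs_iso_pos:
  assumes "dqs_iso P Q f"
  shows "dqs_iso (dqs_pos P) (dqs_pos Q) f"
proof -
  have b: "bij_betw f (verts P) (verts Q)" using assms by (simp add: dqs_iso_def)
  show ?thesis
    using b bij_betwE[OF b] inj_onD[OF bij_betw_imp_inj_on[OF b]] dqs_iso_strict_part[OF assms]
    by (auto simp: dqs_iso_def dqs_pos_def)
qed

lemma dqs_iso_verts: "dqs_iso P Q f \<Longrightarrow> verts Q = f ` verts P"
  by (simp add: dqs_iso_def bij_betw_def)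

lemma dqs_iso_special:
  assumes "dqs_iso P Q f" "dqs_special P"
  shows "dqs_special Q"
  unfolding dqs_special_def total_on_def dqs_iso_verts[OF assms(1)] ball_simps
proof (intro ballI impI)
  fix i j assume "i \<in> verts P" "j \<in> verts P" "f i \<noteq> f j"
  then show "(f i, f j) \<in> le2 Q \<or> (f j, f i) \<in> le2 Q"
    using assms unfolding dqs_iso_def dqs_special_def total_on_def by metis
qed

lemma dqs_iso_trivial:
  assumes "dqs_iso P Q f" "dqs_trivial P"
  shows "dqs_trivial Q"
  unfolding dqs_trivial_def dqs_iso_verts[OF assms(1)] ball_simps
proof (intro ballI impI)
  fix i j assume "i \<in> verts P" "j \<in> verts P" "f i \<noteq> f j"
  then show "(f i, f j) \<notin> le1 Q"
    using assms unfolding dqs_iso_def dqs_trivial_def by metis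
qed

lemma antisym_transport:
  assumes "antisym r" "s \<subseteq> (f ` V) \<times> (f ` V)"
    and "\<And>i j. \<lbrakk>i \<in> V; j \<in> V\<rbrakk> \<Longrightarrow> (i, j) \<in> r \<longleftrightarrow> (f i, f j) \<in> s"
  shows "antisym s"
proof (rule antisymI)
  fix x y assume xy: "(x, y) \<in> s" "(y, x) \<in> s"
  then obtain i j where ij: "i \<in> V" "j \<in> V" "x = f i" "y = f j"
    using assms(2) by blast
  then have "(i, j) \<in> r" "(j, i) \<in> r" using xy assms(3) by simp_all
  then show "x = y" using assms(1) ij by (auto dest: antisymD)
qed

lemma dqs_iso_double_poset:
  assumes "dqs_iso P Q f" "double_quasi_poset Q" "dqs_double_poset P"
  shows "dqs_double_poset Q"
proof -
  have "antisym (le1 Q)" "antisym (le2 Q)"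
    using assms antisym_transport[of "le1 P" "le1 Q" f "verts P"]
      antisym_transport[of "le2 P" "le2 Q" f "verts P"] dqs_iso_verts[OF assms(1)]
    by (simp_all add: dqs_iso_def dqs_double_poset_def double_quasi_poset_def partial_order_on_def
        preorder_on_def)
  then show ?thesis
    using assms(2) by (simp add: dqs_double_poset_def double_quasi_poset_def partial_order_on_def)
qed

lemma closed_subset_iso:
  assumes b: "bij_betw f V W" and "r \<subseteq> V \<times> V" "s \<subseteq> W \<times> W"
    and rs: "\<And>i j. \<lbrakk>i \<in> V; j \<in> V\<rbrakk> \<Longrightarrow> (i, j) \<in> r \<longleftrightarrow> (f i, f j) \<in> s"
  shows "bij_betw ((`) f) {X. X \<subseteq> V \<and> (\<forall>i j. i \<in> X \<and> (i, j) \<in> r \<longrightarrow> j \<in> X)}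
    {X. X \<subseteq> W \<and> (\<forall>i j. i \<in> X \<and> (i, j) \<in> s \<longrightarrow> j \<in> X)}" (is "bij_betw _ ?A ?B")
proof (rule bij_betw_imageI)
  show "inj_on ((`) f) ?A"
    using bij_betw_imp_inj_on[OF b] by (auto simp: inj_on_def inj_on_image_eq_iff)
  have W: "W = f ` V" using b by (simp add: bij_betw_def)
  have inj: "inj_on f V" using b by (rule bij_betw_imp_inj_on)
  show "(`) f ` ?A = ?B"
  proof (intro subset_antisym subsetI)
    fix Y assume "Y \<in> (`) f ` ?A"
    then obtain X where X: "X \<subseteq> V" "\<And>i j. i \<in> X \<Longrightarrow> (i, j) \<in> r \<Longrightarrow> j \<in> X" and Y: "Y = f ` X"
      by blast
    have "j \<in> Y" if "i \<in> Y" "(i, j) \<in> s" for i j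
    proof -
      from that Y obtain i' where i': "i' \<in> X" "i = f i'" by blast
      from that assms(3) W obtain j' where j': "j' \<in> V" "j = f j'" by blast
      have "(i', j') \<in> r" using rs[of i' j'] i' j' X(1) that by auto
      then show ?thesis using X(2) i' j' Y by blast
    qed
    then show "Y \<in> ?B" using X(1) Y W by blast
  next
    fix Y assume Y: "Y \<in> ?B"
    let ?X = "{i \<in> V. f i \<in> Y}"
    have "Y = f ` ?X" using Y W by blast
    moreover have "?X \<in> ?A" using Y rs assms(2) by blast
    ultimately show "Y \<in> (`) f ` ?A" by blast
  qed
qed

lemma bij_betw_opens:
  assumes "dqs_iso P Q f" "double_quasi_poset P" "double_quasi_poset Q"
  shows "bij_betw ((`) f) (opens P) (opens Q)"
  unfolding opens_def using assms
  by (intro closed_subset_iso) (auto simp: dqs_iso_def double_quasi_poset_def preorder_on_def)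

lemma bij_betw_preopens:
  assumes "dqs_iso P Q f" "double_quasi_poset P" "double_quasi_poset Q"
  shows "bij_betw ((`) f) (preopens P) (preopens Q)"
  unfolding preopens_def using assms dqs_iso_strict_part(1)[OF assms(1)]
  by (intro closed_subset_iso)
    (auto simp: dqs_iso_def double_quasi_poset_def preorder_on_def strict_part_def)


subsection \<open>Isomorphism classes and linear structure\<close>

text \<open>
  Every finite double quasi-poset is isomorphic to one whose underlying set is a finite set of
  natural numbers, so the following type is the set of all isomorphism classes.
\<close>

quotient_type dqp = "nat dqs" / partial: dqs_equiv
  morphisms rep_dqp dqp_class
  by (rule dqs_equiv_part_equivp)

lift_definition dqp_degree :: "dqp \<Rightarrow> nat" is "\<lambda>P. card (verts P)"
  by (auto simp: dqs_equiv_def dqs_iso_def intro: bij_betw_same_card)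

lift_definition dqp_empty :: dqp is dqs_empty
  by (auto simp: dqs_equiv_def dqs_empty_def double_quasi_poset_def dqs_iso_def)

text \<open>\<^const>\<open>sum_encode\<close> is only used to move the disjoint union back to natural numbers.\<close>

lift_definition dqp_prod :: "dqp \<Rightarrow> dqp \<Rightarrow> dqp" is
  "\<lambda>P Q. dqs_image sum_encode (dqs_prod P Q)"
proof -
  fix P P' Q Q' :: "nat dqs"
  assume PP: "dqs_equiv P P'" and QQ: "dqs_equiv Q Q'"
  have i: "inj sum_encode" by (rule inj_sum_encode)
  from PP QQ obtain f g where "dqs_iso P P' f" "dqs_iso Q Q' g"
    and D: "double_quasi_poset P" "double_quasi_poset Q" "double_quasi_poset P'"
      "double_quasi_poset Q'"
    by (auto simp: dqs_equiv_def)
  then have "dqs_iso (dqs_prod P Q) (dqs_prod P' Q') (map_sum f g)" by (simp add: dqs_iso_prod)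
  then have "\<exists>h. dqs_iso (dqs_image sum_encode (dqs_prod P Q))
      (dqs_image sum_encode (dqs_prod P' Q')) h"
    using dqs_iso_image[OF i] dqs_iso_sym dqs_iso_trans by metis
  then show "dqs_equiv (dqs_image sum_encode (dqs_prod P Q))
      (dqs_image sum_encode (dqs_prod P' Q'))"
    using D by (simp add: dqs_equiv_def double_quasi_poset_image double_quasi_poset_prod i)
qed

lift_definition dqp_special :: "dqp \<Rightarrow> bool" is dqs_special
  unfolding dqs_equiv_def using dqs_iso_special dqs_iso_sym by blast

lift_definition dqp_trivial :: "dqp \<Rightarrow> bool" is dqs_trivial
  unfolding dqs_equiv_def using dqs_iso_trivial dqs_iso_sym by blast

lift_definition dqp_double_poset :: "dqp \<Rightarrow> bool" is dqs_double_poset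
  unfolding dqs_equiv_def using dqs_iso_double_poset dqs_iso_sym by blast

lift_definition dqp_pos :: "dqp \<Rightarrow> dqp" is dqs_pos
  by (auto simp: dqs_equiv_def intro: double_quasi_poset_pos dqs_iso_pos)

lemma dqp_class_eqI:
  "\<lbrakk>dqs_iso P Q f; double_quasi_poset P; double_quasi_poset Q\<rbrakk> \<Longrightarrow> dqp_class P = dqp_class Q"
  using Quotient_rel_abs[OF Quotient_dqp] by (auto simp: dqs_equiv_def)

definition cut_sum :: "(nat dqs \<Rightarrow> nat set set) \<Rightarrow> nat dqs \<Rightarrow> (dqp \<times> dqp \<Rightarrow>\<^sub>0 'k::field)" where
  "cut_sum T P = (\<Sum>X\<in>T P.
     basis_vec (dqp_class (dqs_restrict P (verts P - X)), dqp_class (dqs_restrict P X)))"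

lemma cut_sum_cong:
  assumes iso: "dqs_iso P Q f" and D: "double_quasi_poset P" "double_quasi_poset Q"
    and b: "bij_betw ((`) f) (T P) (T Q)" and sub: "\<And>X. X \<in> T P \<Longrightarrow> X \<subseteq> verts P"
  shows "cut_sum T P = (cut_sum T Q :: dqp \<times> dqp \<Rightarrow>\<^sub>0 'k::field)"
proof -
  let ?g = "\<lambda>X. basis_vec
    (dqp_class (dqs_restrict Q (verts Q - X)), dqp_class (dqs_restrict Q X)) :: dqp \<times> dqp \<Rightarrow>\<^sub>0 'k"
  have "basis_vec (dqp_class (dqs_restrict P (verts P - X)), dqp_class (dqs_restrict P X))
    = ?g (f ` X)" if "X \<in> T P" for X
  proof -
    have X: "X \<subseteq> verts P" using that by (rule sub)
    have "f ` (verts P - X) = verts Q - f ` X"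
      using iso X by (simp add: dqs_iso_def bij_betw_def inj_on_image_set_diff[of f "verts P"])
    then have "dqp_class (dqs_restrict P (verts P - X))
        = dqp_class (dqs_restrict Q (verts Q - f ` X))"
      using dqp_class_eqI[OF dqs_iso_restrict[OF iso, of "verts P - X"]] D
      by (simp add: double_quasi_poset_restrict)
    moreover have "dqp_class (dqs_restrict P X) = dqp_class (dqs_restrict Q (f ` X))"
      using dqp_class_eqI[OF dqs_iso_restrict[OF iso X]] D
      by (simp add: double_quasi_poset_restrict)
    ultimately show ?thesis by simp
  qed
  then have "cut_sum T P = (\<Sum>X\<in>T P. ?g (f ` X))"
    unfolding cut_sum_def by (intro sum.cong) simp_all
  also have "\<dots> = cut_sum T Q"
    unfolding cut_sum_def by (rule sum.reindex_bij_betw[OF b])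
  finally show ?thesis .
qed

lift_definition dqp_comult :: "dqp \<Rightarrow> (dqp \<times> dqp \<Rightarrow>\<^sub>0 'k::field)" is "cut_sum opens"
  unfolding dqs_equiv_def
  by (auto intro!: cut_sum_cong bij_betw_opens) (auto simp: opens_def)

lift_definition dqp_comult_pre :: "dqp \<Rightarrow> (dqp \<times> dqp \<Rightarrow>\<^sub>0 'k::field)" is "cut_sum preopens"
  unfolding dqs_equiv_def
  by (auto intro!: cut_sum_cong bij_betw_preopens) (auto simp: preopens_def)

type_synonym 'k H_dqp = "dqp \<Rightarrow>\<^sub>0 'k"

definition H_mult :: "'k::field H_dqp \<Rightarrow> 'k H_dqp \<Rightarrow> 'k H_dqp" where
  "H_mult = bilin_ext (\<lambda>a b. basis_vec (dqp_prod a b))"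

definition H_one :: "'k::field H_dqp" where
  "H_one = basis_vec dqp_empty"

definition H_comult :: "'k::field H_dqp \<Rightarrow> (dqp \<times> dqp \<Rightarrow>\<^sub>0 'k)" where
  "H_comult = lin_ext dqp_comult"

definition H_comult_pre :: "'k::field H_dqp \<Rightarrow> (dqp \<times> dqp \<Rightarrow>\<^sub>0 'k)" where
  "H_comult_pre = lin_ext dqp_comult_pre"

text \<open>The counit: the class of the empty double quasi-poset goes to 1, every other class to 0.\<close>

definition H_counit :: "'k::field H_dqp \<Rightarrow> 'k" where
  "H_counit x = Poly_Mapping.lookup x dqp_empty"

definition H_pos :: "'k::field H_dqp \<Rightarrow> 'k H_dqp" where
  "H_pos = lin_ext (\<lambda>a. basis_vec (dqp_pos a))"

definition H_homogeneous :: "nat \<Rightarrow> 'k::field H_dqp set" where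
  "H_homogeneous n = vs.span {basis_vec a | a. dqp_degree a = n}"

definition H_sqp :: "'k::field H_dqp set" where
  "H_sqp = vs.span {basis_vec a | a. dqp_special a}"

definition H_tqp :: "'k::field H_dqp set" where
  "H_tqp = vs.span {basis_vec a | a. dqp_trivial a}"

definition H_dp :: "'k::field H_dqp set" where
  "H_dp = vs.span {basis_vec a | a. dqp_double_poset a}"

end

theory Submission
  imports Defs "HOL-Library.Countable"
begin

text \<open>
  Open and preopen sets are the subsets closed under \<open>\<le>\<^sub>1\<close>, respectively its strict part, and both
  relations commute with restriction and with disjoint union; so the two coproducts are treated at
  once.  Both iterated coproducts are sums over chains \<open>X \<subseteq> Z\<close> of closed subsets, which gives
  coassociativity, and the closed subsets of \<open>PQ\<close> are the unions of one of \<open>P\<close> and one of \<open>Q\<close>, which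
  gives multiplicativity.  The antipode is the convolution inverse of the identity, obtained by
  recursion on the degree; isolating the term of the empty closed subset gives
  \<open>S P = \<epsilon> P - (\<Sum>X \<noteq> {}. S (P | V - X) * (P | X))\<close>, so that by induction every antipode is homogeneous,
  preserves subspaces spanned by classes stable under restriction and product, and commutes with
  the splitting map.  The latter is a coalgebra morphism because the preopen sets of \<open>P\<close> are the
  open sets of \<open>pos P\<close>.
\<close>

section \<open>Linear extensions\<close>

text \<open>Vanishing coefficients contribute nothing, so the supports of \<open>p\<close>,
  \<open>q\<close> and \<open>p + q\<close> can be replaced by one common finite set, over which
  additivity is termwise.\<close>

lemma lin_ext_superset:
  assumes "finite A" "Poly_Mapping.keys p \<subseteq> A"
  shows "lin_ext f p = (\<Sum>b\<in>A. vscale (Poly_Mapping.lookup p b) (f b))"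
  unfolding lin_ext_def using assms by (intro sum.mono_neutral_left) (auto simp: in_keys_iff)

lemma lin_ext_zero [simp]: "lin_ext f 0 = 0"
  by (simp add: lin_ext_def)

lemma lin_ext_single [simp]: "lin_ext f (basis_vec b) = f b"
  by (simp add: lin_ext_def)

lemma lin_ext_add: "lin_ext f (p + q) = lin_ext f p + lin_ext f q"
proof -
  let ?A = "Poly_Mapping.keys p \<union> Poly_Mapping.keys q"
  have "Poly_Mapping.keys (p + q) \<subseteq> ?A" by (rule Poly_Mapping.keys_add)
  then show ?thesis
    by (simp add: lin_ext_superset[of ?A] lookup_add vs.scale_left_distrib sum.distrib)
qed

lemma lin_ext_vscale: "lin_ext f (vscale c p) = vscale c (lin_ext f p)"
proof -
  have "Poly_Mapping.keys (vscale c p) \<subseteq> Poly_Mapping.keys p"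
    by (auto simp: in_keys_iff lookup_vscale)
  then show ?thesis
    by (simp add: lin_ext_superset[of "Poly_Mapping.keys p"] lookup_vscale
        vs.scale_sum_right vs.scale_scale)
qed

lemma linear_lin_ext: "linear_map (lin_ext f)"
  by unfold_locales (simp_all add: lin_ext_add lin_ext_vscale)

lemma lin_ext_sum: "lin_ext f (\<Sum>i\<in>I. g i) = (\<Sum>i\<in>I. lin_ext f (g i))"
  by (induction I rule: infinite_finite_induct) (simp_all add: lin_ext_add)

lemma basis_expansion: "(\<Sum>b\<in>Poly_Mapping.keys p. vscale (Poly_Mapping.lookup p b) (basis_vec b)) = p"
  by (rule poly_mapping_eqI)
    (simp add: lookup_sum lookup_vscale lookup_single when_def in_keys_iff sum.delta' if_distrib
      cong: if_cong)

lemma lin_ext_basis: "lin_ext basis_vec p = p"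
  by (simp add: lin_ext_def basis_expansion)

text \<open>Apply \<open>F\<close> to the finite basis expansion of \<open>p\<close>. Through
  \<open>linear_eqI\<close>, identities of linear maps then need checking on basis vectors
  only.\<close>

lemma linear_eq_lin_ext:
  assumes "linear_map F"
  shows "F p = lin_ext (\<lambda>b. F (basis_vec b)) p"
proof -
  interpret F: Vector_Spaces.linear vscale vscale F by fact
  have "F p = F (lin_ext basis_vec p)" by (simp add: lin_ext_basis)
  then show ?thesis by (simp add: lin_ext_def F.sum F.scale)
qed

lemma linear_form_eq_sum:
  assumes "linear_form F"
  shows "F p = (\<Sum>b\<in>Poly_Mapping.keys p. Poly_Mapping.lookup p b * F (basis_vec b))"
proof -
  interpret F: Vector_Spaces.linear vscale "(*)" F by fact
  have "F p = F (lin_ext basis_vec p)" by (simp add: lin_ext_basis)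
  then show ?thesis by (simp add: lin_ext_def F.sum F.scale)
qed

lemma lin_ext_fun_sum: "lin_ext (\<lambda>b. \<Sum>i\<in>I. g i b) p = (\<Sum>i\<in>I. lin_ext (g i) p)"
  by (simp add: lin_ext_def vs.scale_sum_right sum.swap[of _ _ I])

lemma lin_ext_fun_vscale: "lin_ext (\<lambda>b. vscale c (g b)) p = vscale c (lin_ext g p)"
  by (simp add: lin_ext_def vs.scale_sum_right vs.scale_scale mult.commute)

text \<open>A finite Fubini exchange. It makes the second argument of \<open>bilin_ext\<close> the
  outer one, so that linearity there follows from \<open>linear_lin_ext\<close>.\<close>

lemma lin_ext_swap: "lin_ext (\<lambda>a. lin_ext (h a) y) x = lin_ext (\<lambda>b. lin_ext (\<lambda>a. h a b) x) y"
  by (simp add: lin_ext_def[of "h _"] lin_ext_fun_sum lin_ext_fun_vscale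
      lin_ext_def[of "\<lambda>b. lin_ext (\<lambda>a. h a b) x"])

lemma linear_eqI:
  assumes "linear_map F" "linear_map G" "\<And>b. F (basis_vec b) = G (basis_vec b)"
  shows "F p = G p"
  using linear_eq_lin_ext[OF assms(1), of p] linear_eq_lin_ext[OF assms(2), of p] assms(3) by simp

section \<open>Bilinear extensions and tensor maps\<close>

lemma bilin_ext_single [simp]: "bilin_ext f (basis_vec a) (basis_vec b) = f a b"
  by (simp add: bilin_ext_def)

lemma linear_bilin_ext_right: "linear_map (bilin_ext f x)"
  unfolding bilin_ext_def lin_ext_swap[of f] by (rule linear_lin_ext)

lemma linear_bilin_ext_left: "linear_map (\<lambda>x. bilin_ext f x y)"
  unfolding bilin_ext_def by (rule linear_lin_ext)

lemma linear_sum: "linear_map F \<Longrightarrow> F (\<Sum>i\<in>I. g i) = (\<Sum>i\<in>I. F (g i))"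
  by (rule module_hom.sum[where ?s1.0 = vscale and ?s2.0 = vscale]) (simp add: Vector_Spaces.linear_def)

lemma linear_map_comp: "\<lbrakk>linear_map F; linear_map G\<rbrakk> \<Longrightarrow> linear_map (\<lambda>x. G (F x))"
  using Vector_Spaces.linear_compose[of vscale vscale F vscale G] by (simp add: comp_def)

lemma linear_zero: "linear_map F \<Longrightarrow> F 0 = 0"
  using linear_sum[of F "\<lambda>_. 0" "{}"] by simp

lemma linear_vscale: "linear_map F \<Longrightarrow> F (vscale c x) = vscale c (F x)"
  by (rule module_hom.scale[where ?s1.0 = vscale and ?s2.0 = vscale]) (simp add: Vector_Spaces.linear_def)

lemma linear_diff: "linear_map F \<Longrightarrow> F (x - y) = F x - F y"
  by (rule module_hom.diff[where ?s1.0 = vscale and ?s2.0 = vscale]) (simp add: Vector_Spaces.linear_def)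

lemma linear_form_eqI:
  assumes "linear_form F" "linear_form G" "\<And>b. F (basis_vec b) = G (basis_vec b)"
  shows "F p = G p"
  using linear_form_eq_sum[OF assms(1), of p] linear_form_eq_sum[OF assms(2), of p] assms(3) by simp

lemmas bilin_ext_sum_right = linear_sum[OF linear_bilin_ext_right]
lemmas bilin_ext_sum_left = linear_sum[OF linear_bilin_ext_left]

lemma bilin_ext_sum: "bilin_ext f (\<Sum>i\<in>I. g i) (\<Sum>j\<in>J. h j) = (\<Sum>i\<in>I. \<Sum>j\<in>J. bilin_ext f (g i) (h j))"
  by (simp only: bilin_ext_sum_left) (simp only: bilin_ext_sum_right)

lemma tensor_basis [simp]: "tensor (basis_vec a) (basis_vec b) = basis_vec (a, b)"
  by (simp add: tensor_def)

lemma tensor_map_basis [simp]: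
  "tensor_map f g (basis_vec (a, b)) = tensor (f (basis_vec a)) (g (basis_vec b))"
  by (simp add: tensor_map_def)

lemma linear_tensor_map: "linear_map (tensor_map f g)"
  unfolding tensor_map_def by (rule linear_lin_ext)

subsection \<open>Subspaces spanned by basis vectors\<close>

lemma basis_vec_in_coordinate_subspace: "Q a \<Longrightarrow> basis_vec a \<in> vs.span {basis_vec a | a. Q a}"
  by (rule vs.span_base) blast

lemma linear_image_span:
  assumes "linear_map F" "vs.subspace V" "\<And>a. Q a \<Longrightarrow> F (basis_vec a) \<in> V"
    and "x \<in> vs.span {basis_vec a | a. Q a}"
  shows "F x \<in> V"
proof -
  interpret F: Vector_Spaces.linear vscale vscale F by fact
  have "F x \<in> vs.span (F ` {basis_vec a | a. Q a})" using assms(4) F.span_image by blast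
  also have "\<dots> \<subseteq> V" using assms(2,3) by (intro vs.span_minimal) auto
  finally show ?thesis .
qed

text \<open>The vectors supported on \<open>Q\<close> form a subspace containing the generators, and
  each of them is its own finite basis expansion. Membership in a span of classes thus becomes a
  condition on \<open>keys\<close>.\<close>

lemma coordinate_subspace_eq:
  "vs.span {basis_vec a | a. Q a} = {x :: 'b \<Rightarrow>\<^sub>0 'k::field. \<forall>a\<in>Poly_Mapping.keys x. Q a}"
  (is "?L = ?R")
proof (rule subset_antisym)
  have "vs.subspace ?R"
    by (auto simp: vs.subspace_def in_keys_iff lookup_add lookup_vscale)
  then show "?L \<subseteq> ?R" by (intro vs.span_minimal) auto
  show "?R \<subseteq> ?L"
  proof
    fix x assume "x \<in> ?R"
    then have "(\<Sum>b\<in>Poly_Mapping.keys x. vscale (Poly_Mapping.lookup x b) (basis_vec b)) \<in> ?L"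
      by (intro vs.span_sum vs.span_scale basis_vec_in_coordinate_subspace) auto
    then show "x \<in> ?L" by (simp only: basis_expansion)
  qed
qed

lemma bilin_ext_coordinate_subspace:
  assumes "\<And>a b. \<lbrakk>Q a; R b\<rbrakk> \<Longrightarrow> f a b \<in> V" "vs.subspace V"
    and "x \<in> vs.span {basis_vec a | a. Q a}" "y \<in> vs.span {basis_vec b | b. R b}"
  shows "bilin_ext f x y \<in> V"
proof -
  have "bilin_ext f (basis_vec a) y \<in> V" if "Q a" for a
    using linear_image_span[where F = "bilin_ext f (basis_vec a)" and Q = R,
        OF linear_bilin_ext_right assms(2) _ assms(4)] assms(1) that by simp
  then show ?thesis
    using linear_image_span[where F = "\<lambda>x. bilin_ext f x y" and Q = Q,
        OF linear_bilin_ext_left assms(2) _ assms(3)] by blast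
qed

section \<open>Isomorphism classes\<close>

text \<open>The type \<open>dqp\<close> is built from vertex sets of natural numbers. Encoding by
  \<open>to_nat\<close> gives a class to structures on any countable type, so products can be
  handled directly on sum types.\<close>

definition iso_class :: "'a::countable dqs \<Rightarrow> dqp" where
  "iso_class P = dqp_class (dqs_image to_nat P)"

lemma iso_class_eqI:
  assumes "dqs_iso P Q f" "double_quasi_poset P" "double_quasi_poset Q"
  shows "iso_class P = iso_class Q"
proof -
  have "dqs_iso (dqs_image to_nat P) (dqs_image to_nat Q) (to_nat \<circ> (f \<circ> inv_into (verts P) to_nat))"
    using assms(1) dqs_iso_sym[OF dqs_iso_image[OF inj_to_nat]] dqs_iso_image[OF inj_to_nat]
    by (blast intro: dqs_iso_trans)
  then show ?thesis
    unfolding iso_class_def using assms by (intro dqp_class_eqI) (auto intro: double_quasi_poset_image)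
qed

lemma iso_class_nat: "double_quasi_poset P \<Longrightarrow> iso_class P = dqp_class P"
  unfolding iso_class_def
  by (rule dqp_class_eqI[OF dqs_iso_image[OF inj_to_nat], symmetric])
    (simp_all add: double_quasi_poset_image)

lemma iso_class_exhaust:
  obtains P :: "nat dqs" where "double_quasi_poset P" "a = iso_class P"
proof -
  have "dqs_equiv (rep_dqp a) (rep_dqp a)" "dqp_class (rep_dqp a) = a"
    using Quotient_rep_reflp[OF Quotient_dqp] Quotient_abs_rep[OF Quotient_dqp] by auto
  then show ?thesis using that[of "rep_dqp a"] by (simp add: dqs_equiv_def iso_class_nat)
qed

section \<open>Degree, predicates and splitting computed on representatives\<close>

context
  fixes P :: "'a::countable dqs"
  assumes D: "double_quasi_poset P"
begin

text \<open>The quotient is partial: the \<open>abs_eq\<close> rules ask for a representative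
  related to itself, which amounts to being a double quasi-poset.\<close>

lemma dqs_equiv_image_to_nat: "dqs_equiv (dqs_image (to_nat :: 'a \<Rightarrow> nat) P) (dqs_image to_nat P)"
  using D dqs_iso_trans[OF dqs_iso_sym[OF dqs_iso_image[OF inj_to_nat]] dqs_iso_image[OF inj_to_nat]]
  by (auto simp: dqs_equiv_def double_quasi_poset_image)

lemma dqp_degree_iso_class: "dqp_degree (iso_class P) = card (verts P)"
  unfolding iso_class_def using dqp_degree.abs_eq[OF dqs_equiv_image_to_nat]
  by (simp add: dqs_image_def card_image inj_on_subset[OF inj_to_nat])

lemma double_quasi_poset_to_nat: "double_quasi_poset (dqs_image (to_nat :: 'a \<Rightarrow> nat) P)"
  using D by (simp add: double_quasi_poset_image)

lemma dqp_special_iso_class: "dqp_special (iso_class P) \<longleftrightarrow> dqs_special P"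
  unfolding iso_class_def dqp_special.abs_eq[OF dqs_equiv_image_to_nat]
  using dqs_iso_special dqs_iso_image[OF inj_to_nat] dqs_iso_sym by metis

lemma dqp_trivial_iso_class: "dqp_trivial (iso_class P) \<longleftrightarrow> dqs_trivial P"
  unfolding iso_class_def dqp_trivial.abs_eq[OF dqs_equiv_image_to_nat]
  using dqs_iso_trivial dqs_iso_image[OF inj_to_nat] dqs_iso_sym by metis

lemma dqp_double_poset_iso_class: "dqp_double_poset (iso_class P) \<longleftrightarrow> dqs_double_poset P"
  unfolding iso_class_def dqp_double_poset.abs_eq[OF dqs_equiv_image_to_nat]
  using dqs_iso_double_poset dqs_iso_image[OF inj_to_nat] dqs_iso_sym D double_quasi_poset_to_nat
  by metis

lemma dqp_pos_iso_class: "dqp_pos (iso_class P) = iso_class (dqs_pos P)"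
proof -
  have "dqp_pos (iso_class P) = iso_class (dqs_pos (dqs_image (to_nat :: 'a \<Rightarrow> nat) P))"
    using double_quasi_poset_to_nat
    by (simp add: iso_class_def[of P] dqp_pos.abs_eq[OF dqs_equiv_image_to_nat] iso_class_nat
        double_quasi_poset_pos)
  also have "\<dots> = iso_class (dqs_pos P)"
    using D double_quasi_poset_to_nat
    by (intro iso_class_eqI[symmetric, OF dqs_iso_pos[OF dqs_iso_image[OF inj_to_nat]]]
        double_quasi_poset_pos)
  finally show ?thesis .
qed

end

text \<open>Both \<open>to_nat\<close> and \<open>sum_encode\<close> are isomorphisms onto their
  images, so every encoding in the definition of \<open>dqp_prod\<close> disappears on
  classes.\<close>

lemma dqp_prod_iso_class:
  assumes P: "double_quasi_poset P" and Q: "double_quasi_poset Q"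
  shows "dqp_prod (iso_class P) (iso_class Q) = iso_class (dqs_prod P Q)"
proof -
  let ?P = "dqs_image to_nat P" and ?Q = "dqs_image to_nat Q"
  note D = double_quasi_poset_to_nat[OF P] double_quasi_poset_to_nat[OF Q]
  have "dqp_prod (iso_class P) (iso_class Q) = dqp_class (dqs_image sum_encode (dqs_prod ?P ?Q))"
    unfolding iso_class_def
    by (rule dqp_prod.abs_eq[OF dqs_equiv_image_to_nat[OF P] dqs_equiv_image_to_nat[OF Q]])
  also have "\<dots> = iso_class (dqs_prod ?P ?Q)"
    using D by (subst iso_class_nat[symmetric])
      (auto intro!: double_quasi_poset_image double_quasi_poset_prod inj_sum_encode
        iso_class_eqI[symmetric, OF dqs_iso_image])
  also have "\<dots> = iso_class (dqs_prod P Q)"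
    using D P Q
    by (intro iso_class_eqI[symmetric, OF dqs_iso_prod[OF dqs_iso_image dqs_iso_image]]
        double_quasi_poset_prod) auto
  finally show ?thesis .
qed

section \<open>The graded monoid of isomorphism classes\<close>

lemma double_quasi_poset_empty: "double_quasi_poset dqs_empty"
  by (simp add: dqs_empty_def double_quasi_poset_def)

lemma dqp_empty_eq_iso_class: "dqp_empty = iso_class (dqs_empty :: nat dqs)"
  by (simp add: iso_class_nat double_quasi_poset_empty dqp_empty_def)

lemma iso_class_eq_empty_iff:
  assumes "double_quasi_poset P"
  shows "iso_class P = dqp_empty \<longleftrightarrow> verts P = {}"
proof
  assume "iso_class P = dqp_empty"
  then have "card (verts P) = card (verts (dqs_empty :: nat dqs))"
    by (metis assms double_quasi_poset_empty dqp_degree_iso_class dqp_empty_eq_iso_class)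
  then show "verts P = {}" using assms by (simp add: dqs_empty_def double_quasi_poset_def)
next
  assume "verts P = {}"
  \<comment> \<open>Any function is an isomorphism between structures without vertices, so
    \<open>undefined\<close> serves.\<close>
  then have "dqs_iso P (dqs_empty :: nat dqs) undefined"
    by (simp add: dqs_iso_def dqs_empty_def bij_betw_def)
  then show "iso_class P = dqp_empty"
    unfolding dqp_empty_eq_iso_class using assms double_quasi_poset_empty iso_class_eqI by blast
qed

text \<open>Uniqueness of the class of degree 0 is the source of connectedness.\<close>

lemma dqp_degree_eq_0_iff: "dqp_degree a = 0 \<longleftrightarrow> a = dqp_empty"
proof (cases a rule: iso_class_exhaust)
  case (1 P)
  then show ?thesis
    by (simp add: dqp_degree_iso_class iso_class_eq_empty_iff double_quasi_poset_def)
qed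

lemma dqp_degree_prod: "dqp_degree (dqp_prod a b) = dqp_degree a + dqp_degree b"
proof (cases a rule: iso_class_exhaust; cases b rule: iso_class_exhaust)
  fix P Q :: "nat dqs"
  assume "double_quasi_poset P" "a = iso_class P" "double_quasi_poset Q" "b = iso_class Q"
  then show ?thesis
    by (simp add: dqp_prod_iso_class dqp_degree_iso_class double_quasi_poset_prod)
      (simp add: dqs_prod_def double_quasi_poset_def card_Plus)
qed

lemma dqp_prod_assoc: "dqp_prod (dqp_prod a b) c = dqp_prod a (dqp_prod b c)"
proof (cases a rule: iso_class_exhaust; cases b rule: iso_class_exhaust; cases c rule: iso_class_exhaust)
  fix P Q R :: "nat dqs"
  assume D: "double_quasi_poset P" "double_quasi_poset Q" "double_quasi_poset R"
    and abc: "a = iso_class P" "b = iso_class Q" "c = iso_class R"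
  \<comment> \<open>\<open>?f\<close> and its inverse \<open>?g\<close> move the brackets of the
    triple disjoint union. For either bracketing the cross pairs of \<open>le2\<close> run from
    earlier factors to later ones.\<close>
  let ?f = "\<lambda>x. case x of Inl (Inl i) \<Rightarrow> Inl i | Inl (Inr i) \<Rightarrow> Inr (Inl i) | Inr i \<Rightarrow> Inr (Inr i)"
  let ?g = "\<lambda>x. case x of Inl i \<Rightarrow> Inl (Inl i) | Inr (Inl i) \<Rightarrow> Inl (Inr i) | Inr (Inr i) \<Rightarrow> Inr i"
  have "bij_betw ?f (verts (dqs_prod (dqs_prod P Q) R)) (verts (dqs_prod P (dqs_prod Q R)))"
    by (rule bij_betw_byWitness[where f' = ?g]) (auto simp: dqs_prod_def)
  then have "dqs_iso (dqs_prod (dqs_prod P Q) R) (dqs_prod P (dqs_prod Q R)) ?f"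
    unfolding dqs_iso_def by (auto split: sum.split)
  then show ?thesis
    using D by (simp add: abc dqp_prod_iso_class double_quasi_poset_prod iso_class_eqI)
qed

lemma dqp_prod_empty [simp]: "dqp_prod dqp_empty a = a" "dqp_prod a dqp_empty = a"
proof -
  obtain P :: "nat dqs" where D: "double_quasi_poset P" and a: "a = iso_class P"
    by (rule iso_class_exhaust)
  let ?E = "dqs_empty :: nat dqs"
  have "bij_betw Inr (verts P) (verts (dqs_prod ?E P))" "bij_betw Inl (verts P) (verts (dqs_prod P ?E))"
    by (auto simp: bij_betw_def dqs_prod_def dqs_empty_def)
  then have "dqs_iso P (dqs_prod ?E P) Inr" "dqs_iso P (dqs_prod P ?E) Inl"
    by (auto simp: dqs_iso_def)
  then have "iso_class P = iso_class (dqs_prod ?E P)" "iso_class P = iso_class (dqs_prod P ?E)"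
    using D double_quasi_poset_empty by (blast intro: iso_class_eqI double_quasi_poset_prod)+
  then show "dqp_prod dqp_empty a = a" "dqp_prod a dqp_empty = a"
    unfolding a dqp_empty_eq_iso_class dqp_prod_iso_class[OF double_quasi_poset_empty D]
      dqp_prod_iso_class[OF D double_quasi_poset_empty] by (simp_all only:)
qed

section \<open>Cuts\<close>

text \<open>The flag selects between the two coproducts: \<open>False\<close> gives open sets, \<open>True\<close> preopen sets.\<close>

definition cut_rel :: "bool \<Rightarrow> 'a dqs \<Rightarrow> 'a rel" where
  "cut_rel s P = (if s then strict_part (le1 P) else le1 P)"

definition cuts :: "bool \<Rightarrow> 'a dqs \<Rightarrow> 'a set set" where
  "cuts s P = {X. X \<subseteq> verts P \<and> (\<forall>i j. i \<in> X \<and> (i, j) \<in> cut_rel s P \<longrightarrow> j \<in> X)}"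

definition dqp_cut :: "bool \<Rightarrow> dqp \<Rightarrow> (dqp \<times> dqp \<Rightarrow>\<^sub>0 'k::field)" where
  "dqp_cut s = (if s then dqp_comult_pre else dqp_comult)"

lemma cuts_simps: "cuts False P = opens P" "cuts True P = preopens P"
  by (simp_all add: cuts_def cut_rel_def opens_def preopens_def)

text \<open>The diagonal added by \<open>dqs_pos\<close> imposes no closure condition, so only the
  strict pairs count.\<close>

lemma cuts_pos: "double_quasi_poset P \<Longrightarrow> cuts False (dqs_pos P) = cuts True P"
  by (auto simp: cuts_def cut_rel_def dqs_pos_def)

lemma cuts_subset: "X \<in> cuts s P \<Longrightarrow> X \<subseteq> verts P"
  by (simp add: cuts_def)

lemma finite_cuts: "double_quasi_poset P \<Longrightarrow> finite (cuts s P)"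
  by (rule finite_subset[of _ "Pow (verts P)"]) (auto simp: cuts_def double_quasi_poset_def)

lemma cut_rel_subset: "double_quasi_poset P \<Longrightarrow> cut_rel s P \<subseteq> verts P \<times> verts P"
  by (auto simp: cut_rel_def strict_part_def double_quasi_poset_def preorder_on_def)

lemma empty_in_cuts [simp]: "{} \<in> cuts s P"
  by (simp add: cuts_def)

lemma verts_in_cuts: "double_quasi_poset P \<Longrightarrow> verts P \<in> cuts s P"
  using cut_rel_subset by (fastforce simp: cuts_def)

lemma verts_restrict [simp]: "verts (dqs_restrict P X) = verts P \<inter> X"
  by (simp add: dqs_restrict_def)

lemma restrict_restrict [simp]: "dqs_restrict (dqs_restrict P X) Y = dqs_restrict P (X \<inter> Y)"
  by (auto simp: dqs_restrict_def)

lemma restrict_verts: "double_quasi_poset P \<Longrightarrow> dqs_restrict P (verts P) = P"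
  by (cases P) (auto simp: dqs_restrict_def double_quasi_poset_def preorder_on_def)

text \<open>Strictness of a pair depends only on the pair and its reverse, so taking the strict part
  commutes with restriction. Hence both flags share one argument about nested cuts.\<close>

lemma cut_rel_restrict: "cut_rel s (dqs_restrict P X) = cut_rel s P \<inter> X \<times> X"
  by (auto simp: cut_rel_def dqs_restrict_def strict_part_def)

lemma bij_betw_cuts:
  assumes "dqs_iso P Q f" "double_quasi_poset P" "double_quasi_poset Q"
  shows "bij_betw ((`) f) (cuts s P) (cuts s Q)"
  using bij_betw_opens[OF assms] bij_betw_preopens[OF assms] by (cases s) (simp_all add: cuts_simps)

lemma iso_class_restrict_image:
  assumes "dqs_iso P Q f" "double_quasi_poset P" "double_quasi_poset Q" "X \<subseteq> verts P"
  shows "iso_class (dqs_restrict Q (f ` X)) = iso_class (dqs_restrict P X)"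
  using assms by (intro iso_class_eqI[symmetric, OF dqs_iso_restrict] double_quasi_poset_restrict)

text \<open>The lifted coproducts are computed on the encoded copy of \<open>P\<close>. Taking
  images under \<open>to_nat\<close> matches its cuts with those of \<open>P\<close>, and
  restrictions to matching subsets are isomorphic.\<close>

lemma dqp_cut_iso_class:
  assumes P: "double_quasi_poset P"
  shows "dqp_cut s (iso_class P) =
    (\<Sum>X\<in>cuts s P. basis_vec (iso_class (dqs_restrict P (verts P - X)), iso_class (dqs_restrict P X)))"
proof -
  let ?f = "to_nat :: 'a \<Rightarrow> nat"
  let ?Q = "dqs_image ?f P"
  note Q = double_quasi_poset_to_nat[OF P]
  have iso: "dqs_iso P ?Q ?f" by (simp add: dqs_iso_image)
  have "dqp_cut s (iso_class P) = cut_sum (cuts s) ?Q"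
    unfolding iso_class_def dqp_cut_def cuts_simps cut_sum_def
    using dqp_comult.abs_eq[OF dqs_equiv_image_to_nat[OF P]]
      dqp_comult_pre.abs_eq[OF dqs_equiv_image_to_nat[OF P]]
    by (cases s) (simp_all add: cuts_simps cut_sum_def)
  also have "\<dots> = (\<Sum>X\<in>cuts s P. basis_vec (iso_class (dqs_restrict ?Q (verts ?Q - ?f ` X)),
      iso_class (dqs_restrict ?Q (?f ` X))))"
    unfolding cut_sum_def sum.reindex_bij_betw[OF bij_betw_cuts[OF iso P Q], symmetric]
    by (simp add: iso_class_nat double_quasi_poset_restrict Q)
  also have "\<dots> = (\<Sum>X\<in>cuts s P.
      basis_vec (iso_class (dqs_restrict P (verts P - X)), iso_class (dqs_restrict P X)))"
  proof (rule sum.cong)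
    fix X assume "X \<in> cuts s P"
    then have X: "X \<subseteq> verts P" by (rule cuts_subset)
    have "verts ?Q - ?f ` X = ?f ` (verts P - X)"
      by (simp add: dqs_image_def image_set_diff)
    then show "basis_vec (iso_class (dqs_restrict ?Q (verts ?Q - ?f ` X)), iso_class (dqs_restrict ?Q (?f ` X)))
      = basis_vec (iso_class (dqs_restrict P (verts P - X)), iso_class (dqs_restrict P X))"
      using iso_class_restrict_image[OF iso P Q] X by simp
  qed simp
  finally show ?thesis .
qed

text \<open>Substitute \<open>Z\<close> for the union of \<open>X\<close> and \<open>Y\<close>; then
  \<open>Y\<close> is recovered as \<open>Z - X\<close>. Leaving \<open>F\<close> arbitrary lets the
  identity serve both coassociativity and associativity of convolution.\<close>

lemma sum_cuts_coassoc:
  assumes P: "double_quasi_poset P"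
  shows "(\<Sum>X\<in>cuts s P. \<Sum>Y\<in>cuts s (dqs_restrict P (verts P - X)). F (verts P - X - Y) Y X) =
    (\<Sum>Z\<in>cuts s P. \<Sum>X\<in>cuts s (dqs_restrict P Z). F (verts P - Z) (Z - X) X)"
proof -
  note R = cut_rel_subset[OF P, of s]
  note fin = finite_cuts[OF P] finite_cuts[OF double_quasi_poset_restrict[OF P]]
  have sub: "X \<subseteq> verts P \<inter> Z" if "X \<in> cuts s (dqs_restrict P Z)" for X Z
    using cuts_subset[OF that] by simp
  \<comment> \<open>A successor of a point of \<open>Y\<close> either falls into \<open>X\<close> or
    stays in the complement of \<open>X\<close>, where \<open>Y\<close> is closed.\<close>
  have 1: "X \<union> Y \<in> cuts s P" "X \<in> cuts s (dqs_restrict P (X \<union> Y))"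
    if "X \<in> cuts s P" "Y \<in> cuts s (dqs_restrict P (verts P - X))" for X Y
    using that R by (fastforce simp: cuts_def cut_rel_restrict)+
  \<comment> \<open>A successor of a point of \<open>X\<close> lies in \<open>Z\<close> because
    \<open>Z\<close> is closed, and then in \<open>X\<close>. A successor of a point of
    \<open>Z - X\<close> within the complement of \<open>X\<close> again lies in
    \<open>Z\<close>.\<close>
  have 2: "X \<in> cuts s P" "Z - X \<in> cuts s (dqs_restrict P (verts P - X))"
    if "Z \<in> cuts s P" "X \<in> cuts s (dqs_restrict P Z)" for X Z
    using that R by (fastforce simp: cuts_def cut_rel_restrict)+
  show ?thesis
    unfolding sum.Sigma[OF fin(1) ballI[OF fin(2)]]
  proof (rule sum.reindex_bij_witness[where i = "\<lambda>(Z, X). (X, Z - X)" and j = "\<lambda>(X, Y). (X \<union> Y, X)"];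
      clarsimp)
    fix X Y assume XY: "X \<in> cuts s P" "Y \<in> cuts s (dqs_restrict P (verts P - X))"
    show "X \<union> Y - X = Y" using sub[OF XY(2)] by blast
    show "X \<union> Y \<in> cuts s P \<and> X \<in> cuts s (dqs_restrict P (X \<union> Y))" using 1[OF XY] by simp
    have "verts P - (X \<union> Y) = verts P - X - Y" "X \<union> Y - X = Y" using sub[OF XY(2)] by auto
    then show "F (verts P - (X \<union> Y)) (X \<union> Y - X) X = F (verts P - X - Y) Y X" by simp
  next
    fix Z X assume ZX: "Z \<in> cuts s P" "X \<in> cuts s (dqs_restrict P Z)"
    show "X \<union> Z = Z" using sub[OF ZX(2)] by blast
    show "X \<in> cuts s P \<and> Z - X \<in> cuts s (dqs_restrict P (verts P - X))" using 2[OF ZX] by simp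
  qed
qed

lemma dqp_cut_restrict:
  assumes "double_quasi_poset P" "A \<subseteq> verts P"
  shows "dqp_cut s (iso_class (dqs_restrict P A)) = (\<Sum>X\<in>cuts s (dqs_restrict P A).
    basis_vec (iso_class (dqs_restrict P (A - X)), iso_class (dqs_restrict P X)))"
  unfolding dqp_cut_iso_class[OF double_quasi_poset_restrict[OF assms(1)]]
proof (rule sum.cong)
  fix X assume "X \<in> cuts s (dqs_restrict P A)"
  then have "X \<subseteq> A" using cuts_subset by fastforce
  then have "A \<inter> (verts P \<inter> A - X) = A - X" "A \<inter> X = X" using assms(2) by auto
  then show "basis_vec (iso_class (dqs_restrict (dqs_restrict P A) (verts (dqs_restrict P A) - X)),
        iso_class (dqs_restrict (dqs_restrict P A) X))
      = basis_vec (iso_class (dqs_restrict P (A - X)), iso_class (dqs_restrict P X))"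
    by simp
qed simp

section \<open>Cuts of products\<close>

lemma restrict_prod:
  "dqs_restrict (dqs_prod P Q) (X <+> Y) = dqs_prod (dqs_restrict P X) (dqs_restrict Q Y)"
  by (auto simp: dqs_restrict_def dqs_prod_def)

lemma cut_rel_prod_simps [simp]:
  "(Inl i, Inl i') \<in> cut_rel s (dqs_prod P Q) \<longleftrightarrow> (i, i') \<in> cut_rel s P"
  "(Inr j, Inr j') \<in> cut_rel s (dqs_prod P Q) \<longleftrightarrow> (j, j') \<in> cut_rel s Q"
  "(Inl i, Inr j) \<notin> cut_rel s (dqs_prod P Q)"
  "(Inr j, Inl i) \<notin> cut_rel s (dqs_prod P Q)"
  by (auto simp: cut_rel_def strict_part_def)

text \<open>No pair of \<open>le1\<close>, strict or not, joins the two factors, so the traces of a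
  cut on them can be chosen independently.\<close>

lemma bij_betw_cuts_prod:
  "bij_betw (\<lambda>(X, Y). X <+> Y) (cuts s P \<times> cuts s Q) (cuts s (dqs_prod P Q))"
proof (rule bij_betw_byWitness[where f' = "\<lambda>Z. (Inl -` Z, Inr -` Z)"])
  show "\<forall>p\<in>cuts s P \<times> cuts s Q. (Inl -` (case p of (X, Y) \<Rightarrow> X <+> Y), Inr -` (case p of (X, Y) \<Rightarrow> X <+> Y)) = p"
    by auto
  show "\<forall>Z\<in>cuts s (dqs_prod P Q). (case (Inl -` Z, Inr -` Z) of (X, Y) \<Rightarrow> X <+> Y) = Z"
    by (auto, metis InlI InrI old.sum.exhaust vimageI2)
  show "(\<lambda>(X, Y). X <+> Y) ` (cuts s P \<times> cuts s Q) \<subseteq> cuts s (dqs_prod P Q)"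
  proof (clarsimp simp: cuts_def, intro conjI allI impI)
    fix X Y assume XY: "X \<subseteq> verts P" "\<forall>i j. i \<in> X \<and> (i, j) \<in> cut_rel s P \<longrightarrow> j \<in> X"
      "Y \<subseteq> verts Q" "\<forall>i j. i \<in> Y \<and> (i, j) \<in> cut_rel s Q \<longrightarrow> j \<in> Y"
    then show "X <+> Y \<subseteq> verts (dqs_prod P Q)" by auto
    show "j \<in> X <+> Y" if "i \<in> X <+> Y \<and> (i, j) \<in> cut_rel s (dqs_prod P Q)" for i j
      using that XY by (cases i; cases j) auto
  qed
  show "(\<lambda>Z. (Inl -` Z, Inr -` Z)) ` cuts s (dqs_prod P Q) \<subseteq> cuts s P \<times> cuts s Q"
  proof clarify
    fix Z assume Z: "Z \<in> cuts s (dqs_prod P Q)"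
    then have "\<And>z. z \<in> Z \<Longrightarrow> z \<in> verts (dqs_prod P Q)"
      and "\<And>i j. \<lbrakk>i \<in> Z; (i, j) \<in> cut_rel s (dqs_prod P Q)\<rbrakk> \<Longrightarrow> j \<in> Z"
      by (auto simp: cuts_def)
    from this(1)[of "Inl _"] this(1)[of "Inr _"] this(2)[of "Inl _" "Inl _"] this(2)[of "Inr _" "Inr _"]
    show "Inl -` Z \<in> cuts s P \<and> Inr -` Z \<in> cuts s Q"
      unfolding cuts_def by simp blast
  qed
qed

lemma dqp_cut_prod:
  assumes P: "double_quasi_poset P" and Q: "double_quasi_poset Q"
  shows "dqp_cut s (dqp_prod (iso_class P) (iso_class Q)) = (\<Sum>X\<in>cuts s P. \<Sum>Y\<in>cuts s Q.
    basis_vec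
     (dqp_prod (iso_class (dqs_restrict P (verts P - X))) (iso_class (dqs_restrict Q (verts Q - Y))),
      dqp_prod (iso_class (dqs_restrict P X)) (iso_class (dqs_restrict Q Y))))"
proof -
  have "verts (dqs_prod P Q) - (X <+> Y) = (verts P - X) <+> (verts Q - Y)" for X Y
    by (auto simp: dqs_prod_def)
  then show ?thesis
    by (simp add: dqp_prod_iso_class dqp_cut_iso_class double_quasi_poset_prod
        double_quasi_poset_restrict P Q sum.reindex_bij_betw[OF bij_betw_cuts_prod, symmetric]
        sum.cartesian_product case_prod_unfold restrict_prod)
qed

section \<open>Splitting\<close>

lemma restrict_pos: "dqs_restrict (dqs_pos P) X = dqs_pos (dqs_restrict P X)"
  by (auto simp: dqs_restrict_def dqs_pos_def strict_part_def)

text \<open>On representatives the two structures are equal: \<open>le1\<close> has no cross pairs,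
  and those of \<open>le2\<close> all run from \<open>P\<close> to \<open>Q\<close>, hence are
  strict and survive the splitting.\<close>

lemma dqp_pos_prod: "dqp_pos (dqp_prod a b) = dqp_prod (dqp_pos a) (dqp_pos b)"
proof (cases a rule: iso_class_exhaust; cases b rule: iso_class_exhaust)
  fix P Q :: "nat dqs"
  assume D: "double_quasi_poset P" "double_quasi_poset Q" and ab: "a = iso_class P" "b = iso_class Q"
  have "le1 (dqs_pos (dqs_prod P Q)) = le1 (dqs_prod (dqs_pos P) (dqs_pos Q))"
    by (auto simp: dqs_pos_def dqs_prod_def strict_part_def)
  moreover have "le2 (dqs_pos (dqs_prod P Q)) = le2 (dqs_prod (dqs_pos P) (dqs_pos Q))"
    by (auto simp: dqs_pos_def dqs_prod_def strict_part_def)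
  ultimately have "dqs_pos (dqs_prod P Q) = dqs_prod (dqs_pos P) (dqs_pos Q)"
    by (simp add: dqs_pos_def dqs_prod_def)
  then show ?thesis
    using D by (simp add: ab dqp_prod_iso_class dqp_pos_iso_class double_quasi_poset_prod
        double_quasi_poset_pos)
qed

lemma dqp_degree_pos: "dqp_degree (dqp_pos a) = dqp_degree a"
proof (cases a rule: iso_class_exhaust)
  case (1 P)
  then have "dqp_degree (dqp_pos a) = card (verts (dqs_pos P))"
    by (simp add: dqp_pos_iso_class dqp_degree_iso_class double_quasi_poset_pos)
  also have "\<dots> = dqp_degree a" using 1 by (simp add: dqp_degree_iso_class dqs_pos_def)
  finally show ?thesis .
qed

lemma dqp_pos_eq_empty_iff [simp]: "dqp_pos a = dqp_empty \<longleftrightarrow> a = dqp_empty"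
  by (metis dqp_degree_eq_0_iff dqp_degree_pos)

text \<open>A strict part never contains a pair together with its reverse, which gives
  antisymmetry.\<close>

lemma dqp_double_poset_pos: "dqp_double_poset (dqp_pos a)"
proof (cases a rule: iso_class_exhaust)
  case (1 P)
  then have "dqs_double_poset (dqs_pos P)"
    using double_quasi_poset_pos[OF 1(1)]
    by (auto simp: dqs_double_poset_def double_quasi_poset_def partial_order_on_def dqs_pos_def
        antisym_def strict_part_def)
  then show ?thesis
    by (simp add: 1 dqp_pos_iso_class dqp_double_poset_iso_class double_quasi_poset_pos)
qed

lemma dqp_pos_double_poset:
  assumes "dqp_double_poset a"
  shows "dqp_pos a = a"
proof (cases a rule: iso_class_exhaust)
  case (1 P)
  then have "dqs_double_poset P" using assms by (simp add: dqp_double_poset_iso_class)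
  then have "strict_part (le1 P) \<union> Id_on (verts P) = le1 P" "strict_part (le2 P) \<union> Id_on (verts P) = le2 P"
    by (auto simp: dqs_double_poset_def partial_order_on_def preorder_on_def refl_on_def strict_part_def
        antisym_def Id_on_def)
  then have "dqs_pos P = P" by (simp add: dqs_pos_def)
  then show ?thesis using 1 by (simp add: dqp_pos_iso_class)
qed

section \<open>The bialgebras\<close>

definition H_cut :: "bool \<Rightarrow> 'k::field H_dqp \<Rightarrow> (dqp \<times> dqp \<Rightarrow>\<^sub>0 'k)" where
  "H_cut s = lin_ext (dqp_cut s)"

lemma H_comult_eq_H_cut: "H_comult = H_cut False" "H_comult_pre = H_cut True"
  by (simp_all add: H_comult_def H_comult_pre_def H_cut_def dqp_cut_def fun_eq_iff)

lemma H_cut_basis [simp]: "H_cut s (basis_vec a) = dqp_cut s a"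
  by (simp add: H_cut_def)

lemma linear_H_cut: "linear_map (H_cut s)"
  unfolding H_cut_def by (rule linear_lin_ext)

section \<open>Algebra structure and counit\<close>

lemma H_mult_basis [simp]: "H_mult (basis_vec a) (basis_vec b) = basis_vec (dqp_prod a b)"
  by (simp add: H_mult_def)

lemma linear_H_mult_right: "linear_map (H_mult x)"
  unfolding H_mult_def by (rule linear_bilin_ext_right)

lemma linear_H_mult_left: "linear_map (\<lambda>x. H_mult x y)"
  unfolding H_mult_def by (rule linear_bilin_ext_left)

lemmas H_mult_sum_right = linear_sum[OF linear_H_mult_right]
lemmas H_mult_sum_left = linear_sum[OF linear_H_mult_left]

lemma H_mult_assoc: "H_mult (H_mult x y) z = H_mult x (H_mult y z)"
proof -
  \<comment> \<open>Both sides are linear in each argument. The arguments are released from basis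
    vectors one at a time, the last one first.\<close>
  have 1: "H_mult (H_mult (basis_vec a) (basis_vec b)) z = H_mult (basis_vec a) (H_mult (basis_vec b) z)"
    for a b
    by (rule linear_eqI[OF linear_H_mult_right linear_map_comp[OF linear_H_mult_right linear_H_mult_right]])
      (simp add: dqp_prod_assoc)
  have 2: "H_mult (H_mult (basis_vec a) y) z = H_mult (basis_vec a) (H_mult y z)" for a
    using linear_eqI[where F = "\<lambda>y. H_mult (H_mult (basis_vec a) y) z",
        OF linear_map_comp[OF linear_H_mult_right linear_H_mult_left]
          linear_map_comp[OF linear_H_mult_left linear_H_mult_right]] 1
    by blast
  show ?thesis
    using linear_eqI[where F = "\<lambda>x. H_mult (H_mult x y) z",
        OF linear_map_comp[OF linear_H_mult_left linear_H_mult_left] linear_H_mult_left] 2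
    by blast
qed

lemma H_mult_one [simp]: "H_mult H_one x = x" "H_mult x H_one = x"
proof -
  show "H_mult H_one x = x"
    by (rule linear_eqI[OF linear_H_mult_right vs.linear_ident]) (simp add: H_one_def)
  show "H_mult x H_one = x"
    by (rule linear_eqI[OF linear_H_mult_left vs.linear_ident]) (simp add: H_one_def)
qed

lemma H_counit_basis: "H_counit (basis_vec a) = (if a = dqp_empty then 1 else 0)"
  by (simp add: H_counit_def lookup_single when_def)

lemma linear_H_counit: "linear_form H_counit"
  by unfold_locales (simp_all add: H_counit_def lookup_add lookup_vscale algebra_simps)

lemma H_counit_one: "H_counit H_one = 1"
  by (simp add: H_counit_basis H_one_def)

text \<open>Degrees are natural numbers and add up, so a product has degree 0 only if both factors
  have. This is multiplicativity of the counit on classes.\<close>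

lemma dqp_prod_eq_empty_iff: "dqp_prod a b = dqp_empty \<longleftrightarrow> a = dqp_empty \<and> b = dqp_empty"
  by (simp add: dqp_degree_prod flip: dqp_degree_eq_0_iff)

lemma H_counit_mult: "H_counit (H_mult x y) = H_counit x * H_counit y"
proof -
  note add = module_hom.add[where ?s1.0 = vscale and ?s2.0 = vscale]
  have H: "module_hom vscale vscale (H_mult x)" "module_hom vscale vscale (\<lambda>x. H_mult x y)" for x y :: "'a H_dqp"
    using linear_H_mult_left[of y] linear_H_mult_right[of x] by (simp_all only: Vector_Spaces.linear_def)
  have L: "linear_form (\<lambda>x. H_counit (H_mult x y))" "linear_form (\<lambda>y. H_counit (H_mult x y))"
    "linear_form (\<lambda>x. H_counit x * c)" "linear_form (\<lambda>x. c * H_counit x)" for x y :: "'a H_dqp" and c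
    by unfold_locales
      (simp_all add: add[OF H(1)] add[OF H(2)] linear_vscale[OF linear_H_mult_left]
        linear_vscale[OF linear_H_mult_right] H_counit_def lookup_add lookup_vscale algebra_simps)
  have "H_counit (H_mult (basis_vec a) y) = H_counit (basis_vec a) * H_counit y" for a
    by (rule linear_form_eqI[OF L(2) L(4)]) (simp add: H_counit_basis dqp_prod_eq_empty_iff)
  then show ?thesis
    by (rule linear_form_eqI[OF L(1) L(3)])
qed

section \<open>Coalgebra axioms\<close>

lemma linear_tensor: "linear_map (tensor x)" "linear_map (\<lambda>x. tensor x y)"
  unfolding tensor_def by (rule linear_bilin_ext_right linear_bilin_ext_left)+

lemma linear_contract: "linear_map (contract_left e)" "linear_map (contract_right e)"
  unfolding contract_left_def contract_right_def by (rule linear_lin_ext)+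

lemma linear_tensor_assoc: "linear_map tensor_assoc"
  unfolding tensor_assoc_def by (rule linear_lin_ext)

lemma H_cut_coassoc:
  fixes x :: "'k::field H_dqp"
  shows "tensor_assoc (tensor_map (H_cut s) id (H_cut s x)) = tensor_map id (H_cut s) (H_cut s x)"
proof (rule linear_eqI[OF
      linear_map_comp[OF linear_map_comp[OF linear_H_cut linear_tensor_map] linear_tensor_assoc]
      linear_map_comp[OF linear_H_cut linear_tensor_map]])
  fix a
  obtain P :: "nat dqs" where P: "double_quasi_poset P" and a: "a = iso_class P"
    by (rule iso_class_exhaust)
  have R: "\<And>X. X \<in> cuts s P \<Longrightarrow> X \<subseteq> verts P" by (rule cuts_subset)
  let ?c = "\<lambda>X. iso_class (dqs_restrict P X)"
  have "tensor_assoc (tensor_map (H_cut s) id (H_cut s (basis_vec a) :: dqp \<times> dqp \<Rightarrow>\<^sub>0 'k))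
    = (\<Sum>X\<in>cuts s P. \<Sum>Y\<in>cuts s (dqs_restrict P (verts P - X)).
        basis_vec (?c (verts P - X - Y), ?c Y, ?c X))"
    using P by (simp add: a dqp_cut_iso_class dqp_cut_restrict linear_sum[OF linear_tensor_map]
        linear_sum[OF linear_tensor_assoc] linear_sum[OF linear_tensor(2)])
      (simp add: tensor_assoc_def)
  also have "\<dots> = (\<Sum>Z\<in>cuts s P. \<Sum>X\<in>cuts s (dqs_restrict P Z).
        basis_vec (?c (verts P - Z), ?c (Z - X), ?c X))"
    by (rule sum_cuts_coassoc[OF P])
  also have "\<dots> = tensor_map id (H_cut s) (H_cut s (basis_vec a))"
    using P R by (simp add: a dqp_cut_iso_class dqp_cut_restrict linear_sum[OF linear_tensor_map]
        linear_sum[OF linear_tensor(1)])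
  finally show "tensor_assoc (tensor_map (H_cut s) id (H_cut s (basis_vec a) :: dqp \<times> dqp \<Rightarrow>\<^sub>0 'k))
    = tensor_map id (H_cut s) (H_cut s (basis_vec a))" .
qed

lemma restrict_eq_empty_iff:
  "\<lbrakk>double_quasi_poset P; X \<subseteq> verts P\<rbrakk> \<Longrightarrow> iso_class (dqs_restrict P X) = dqp_empty \<longleftrightarrow> X = {}"
  by (auto simp: iso_class_eq_empty_iff double_quasi_poset_restrict)

text \<open>The counit kills every nonempty class, so this is the sum left by the right counit law,
  where \<open>{}\<close> is the only surviving cut. In the companion lemma for the left law it is
  \<open>verts P\<close>.\<close>

lemma sum_cuts_delta_empty:
  assumes "double_quasi_poset P"
  shows "(\<Sum>X\<in>cuts s P. if iso_class (dqs_restrict P X) = dqp_empty then g X else 0) = g {}"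
proof -
  have "(\<Sum>X\<in>cuts s P. if iso_class (dqs_restrict P X) = dqp_empty then g X else 0)
    = (\<Sum>X\<in>cuts s P. if X = {} then g X else 0)"
    by (intro sum.cong) (simp_all add: assms restrict_eq_empty_iff cuts_subset)
  then show ?thesis using assms by (simp add: finite_cuts)
qed

lemma sum_cuts_delta_full:
  assumes "double_quasi_poset P"
  shows "(\<Sum>X\<in>cuts s P. if iso_class (dqs_restrict P (verts P - X)) = dqp_empty then g X else 0)
    = g (verts P)"
proof -
  have "(\<Sum>X\<in>cuts s P. if iso_class (dqs_restrict P (verts P - X)) = dqp_empty then g X else 0)
    = (\<Sum>X\<in>cuts s P. if X = verts P then g X else 0)"
    using cuts_subset[of _ s P]
    by (intro sum.cong) (auto simp: assms restrict_eq_empty_iff)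
  then show ?thesis using assms by (simp add: finite_cuts verts_in_cuts)
qed

lemma H_cut_counit_left: "contract_left H_counit (H_cut s x) = (x :: 'k::field H_dqp)"
proof (rule linear_eqI[OF linear_map_comp[OF linear_H_cut linear_contract(1)] vs.linear_ident])
  fix a
  obtain P :: "nat dqs" where P: "double_quasi_poset P" and a: "a = iso_class P"
    by (rule iso_class_exhaust)
  have "contract_left H_counit (H_cut s (basis_vec a) :: dqp \<times> dqp \<Rightarrow>\<^sub>0 'k)
    = (\<Sum>X\<in>cuts s P. if iso_class (dqs_restrict P (verts P - X)) = dqp_empty
        then basis_vec (iso_class (dqs_restrict P X)) else 0)"
    unfolding a H_cut_basis dqp_cut_iso_class[OF P] contract_left_def lin_ext_sum lin_ext_single
    by (intro sum.cong) (simp_all add: H_counit_basis)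
  then show "contract_left H_counit (H_cut s (basis_vec a) :: dqp \<times> dqp \<Rightarrow>\<^sub>0 'k) = basis_vec a"
    by (simp add: sum_cuts_delta_full P restrict_verts a)
qed

lemma H_cut_counit_right: "contract_right H_counit (H_cut s x) = (x :: 'k::field H_dqp)"
proof (rule linear_eqI[OF linear_map_comp[OF linear_H_cut linear_contract(2)] vs.linear_ident])
  fix a
  obtain P :: "nat dqs" where P: "double_quasi_poset P" and a: "a = iso_class P"
    by (rule iso_class_exhaust)
  have "contract_right H_counit (H_cut s (basis_vec a) :: dqp \<times> dqp \<Rightarrow>\<^sub>0 'k)
    = (\<Sum>X\<in>cuts s P. if iso_class (dqs_restrict P X) = dqp_empty
        then basis_vec (iso_class (dqs_restrict P (verts P - X))) else 0)"
    unfolding a H_cut_basis dqp_cut_iso_class[OF P] contract_right_def lin_ext_sum lin_ext_single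
    by (intro sum.cong) (simp_all add: H_counit_basis)
  then show "contract_right H_counit (H_cut s (basis_vec a) :: dqp \<times> dqp \<Rightarrow>\<^sub>0 'k) = basis_vec a"
    by (simp add: sum_cuts_delta_empty P restrict_verts a)
qed

section \<open>Compatibility of the coproducts with product and unit\<close>

lemma linear_tensor_mult: "linear_map (tensor_mult m x)" "linear_map (\<lambda>x. tensor_mult m x y)"
  unfolding tensor_mult_def by (rule linear_bilin_ext_right linear_bilin_ext_left)+

lemma H_cut_mult:
  fixes x y :: "'k::field H_dqp"
  shows "H_cut s (H_mult x y) = tensor_mult H_mult (H_cut s x) (H_cut s y)"
proof -
  have B: "H_cut s (H_mult (basis_vec a) (basis_vec b)) =
      tensor_mult H_mult (H_cut s (basis_vec a)) (H_cut s (basis_vec b) :: dqp \<times> dqp \<Rightarrow>\<^sub>0 'k)" for a b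
  proof (cases a rule: iso_class_exhaust; cases b rule: iso_class_exhaust)
    fix P Q :: "nat dqs"
    assume "double_quasi_poset P" "double_quasi_poset Q" and ab: "a = iso_class P" "b = iso_class Q"
    then show ?thesis
      by (simp add: ab dqp_cut_prod dqp_cut_iso_class tensor_mult_def bilin_ext_sum)
  qed
  have "H_cut s (H_mult (basis_vec a) y) = tensor_mult H_mult (H_cut s (basis_vec a)) (H_cut s y)" for a
    by (rule linear_eqI[OF linear_map_comp[OF linear_H_mult_right linear_H_cut]
          linear_map_comp[OF linear_H_cut linear_tensor_mult(1)] B])
  then show ?thesis
    by (rule linear_eqI[where F = "\<lambda>x. H_cut s (H_mult x y)"
          and G = "\<lambda>x. tensor_mult H_mult (H_cut s x) (H_cut s y)",
          OF linear_map_comp[OF linear_H_mult_left linear_H_cut]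
            linear_map_comp[OF linear_H_cut linear_tensor_mult(2)]])
qed

lemma dqp_cut_empty: "dqp_cut s dqp_empty = basis_vec (dqp_empty, dqp_empty)"
proof -
  let ?E = "dqs_empty :: nat dqs"
  have "cuts s ?E = {{}}" "dqs_restrict ?E {} = ?E" "verts ?E - {} = {}"
    by (auto simp: cuts_def dqs_empty_def dqs_restrict_def)
  then show ?thesis
    by (simp add: dqp_empty_eq_iso_class dqp_cut_iso_class double_quasi_poset_empty)
qed

lemma H_cut_one: "H_cut s H_one = tensor H_one H_one"
  by (simp add: H_one_def dqp_cut_empty)

theorem bialgebra_H_cut: "bialgebra H_mult (H_one :: 'k::field H_dqp) (H_cut s) H_counit"
  unfolding bialgebra_def unital_algebra_def counital_coalgebra_def bialgebra_axioms_def
  by (simp add: H_mult_assoc H_counit_one H_cut_mult H_counit_mult H_cut_counit_left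
      H_cut_counit_right H_cut_coassoc linear_H_cut linear_H_mult_left linear_H_mult_right
      linear_H_counit H_cut_one)

section \<open>Convolution and the antipode\<close>

text \<open>\<open>mult_lin\<close> is prescribed on basis tensors; bilinearity carries the formula
  to all pure tensors.\<close>

lemma mult_lin_tensor: "mult_lin H_mult (tensor x y) = H_mult x y"
proof -
  have M: "linear_map (mult_lin H_mult :: (dqp \<times> dqp \<Rightarrow>\<^sub>0 'a) \<Rightarrow> 'a H_dqp)"
    unfolding mult_lin_def by (rule linear_lin_ext)
  have "mult_lin H_mult (tensor (basis_vec a) y) = H_mult (basis_vec a) y" for a and y :: "'a H_dqp"
    by (rule linear_eqI[OF linear_map_comp[OF linear_tensor(1) M] linear_H_mult_right])
      (simp add: mult_lin_def)
  then show ?thesis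
    by (rule linear_eqI[OF linear_map_comp[OF linear_tensor(2) M] linear_H_mult_left])
qed

text \<open>Linear maps are recorded by their values on classes, so no linearity assumption has to
  be carried through the convolution calculus.\<close>

definition convolution ::
  "bool \<Rightarrow> (dqp \<Rightarrow> 'k::field H_dqp) \<Rightarrow> (dqp \<Rightarrow> 'k H_dqp) \<Rightarrow> dqp \<Rightarrow> 'k H_dqp" where
  "convolution s f g a = lin_ext (\<lambda>p. H_mult (f (fst p)) (g (snd p))) (dqp_cut s a)"

text \<open>The composite of counit and unit, evaluated on classes; it is neutral for
  convolution.\<close>

definition conv_unit :: "dqp \<Rightarrow> 'k::field H_dqp" where
  "conv_unit a = (if a = dqp_empty then H_one else 0)"

lemma convolution_iso_class:
  assumes "double_quasi_poset P"
  shows "convolution s f g (iso_class P) = (\<Sum>X\<in>cuts s P.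
    H_mult (f (iso_class (dqs_restrict P (verts P - X)))) (g (iso_class (dqs_restrict P X))))"
  by (simp add: convolution_def dqp_cut_iso_class assms lin_ext_sum)

lemma convolution_restrict:
  assumes "double_quasi_poset P" "A \<subseteq> verts P"
  shows "convolution s f g (iso_class (dqs_restrict P A)) = (\<Sum>X\<in>cuts s (dqs_restrict P A).
    H_mult (f (iso_class (dqs_restrict P (A - X)))) (g (iso_class (dqs_restrict P X))))"
  by (simp add: convolution_def dqp_cut_restrict assms lin_ext_sum)

lemma convolution_assoc:
  "convolution s (convolution s f g) h = convolution s f (convolution s g h)"
proof
  fix a
  obtain P :: "nat dqs" where P: "double_quasi_poset P" and a: "a = iso_class P"
    by (rule iso_class_exhaust)
  have R: "\<And>X. X \<in> cuts s P \<Longrightarrow> X \<subseteq> verts P" by (rule cuts_subset)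
  let ?c = "\<lambda>X. iso_class (dqs_restrict P X)"
  have "convolution s (convolution s f g) h a =
    (\<Sum>X\<in>cuts s P. \<Sum>Y\<in>cuts s (dqs_restrict P (verts P - X)).
      H_mult (H_mult (f (?c (verts P - X - Y))) (g (?c Y))) (h (?c X)))"
    using P by (simp add: a convolution_iso_class convolution_restrict H_mult_sum_left)
  also have "\<dots> = (\<Sum>Z\<in>cuts s P. \<Sum>X\<in>cuts s (dqs_restrict P Z).
      H_mult (H_mult (f (?c (verts P - Z))) (g (?c (Z - X)))) (h (?c X)))"
    by (rule sum_cuts_coassoc[OF P])
  also have "\<dots> = convolution s f (convolution s g h) a"
    using P R by (simp add: a convolution_iso_class convolution_restrict H_mult_sum_right H_mult_assoc)
  finally show "convolution s (convolution s f g) h a = convolution s f (convolution s g h) a" .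
qed

lemma convolution_unit: "convolution s f conv_unit = f" "convolution s conv_unit f = f"
proof -
  have "convolution s f conv_unit a = f a \<and> convolution s conv_unit f a = f a" for a
  proof (cases a rule: iso_class_exhaust)
    case (1 P)
    have "H_mult (f b) (conv_unit c) = (if c = dqp_empty then f b else 0)"
      "H_mult (conv_unit c) (f b) = (if c = dqp_empty then f b else 0)" for b c
      by (simp_all add: conv_unit_def linear_zero[OF linear_H_mult_left] linear_zero[OF linear_H_mult_right])
    then show ?thesis
      using 1 by (simp add: convolution_iso_class sum_cuts_delta_empty sum_cuts_delta_full restrict_verts)
  qed
  then show "convolution s f conv_unit = f" "convolution s conv_unit f = f" by (simp_all add: fun_eq_iff)
qed

text \<open>The cut \<open>{}\<close> contributes the value of \<open>g\<close> at \<open>P\<close>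
  times the unit. All other terms evaluate \<open>g\<close> in smaller degree, so a convolution
  equation can be solved recursively for \<open>g\<close>.\<close>

lemma convolution_split:
  assumes P: "double_quasi_poset P" and f: "f dqp_empty = H_one"
  shows "convolution s g f (iso_class P) = g (iso_class P) + (\<Sum>X\<in>cuts s P - {{}}.
    H_mult (g (iso_class (dqs_restrict P (verts P - X)))) (f (iso_class (dqs_restrict P X))))"
proof -
  have "iso_class (dqs_restrict P {}) = dqp_empty" using P by (simp add: restrict_eq_empty_iff)
  then show ?thesis
    unfolding convolution_iso_class[OF P] sum.remove[OF finite_cuts[OF P] empty_in_cuts]
    by (simp add: f restrict_verts P)
qed

text \<open>The recursive calls of \<open>conv_left_inverse\<close> sit under
  \<open>lin_ext\<close>; this congruence makes their context available to the termination
  proof.\<close>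

lemma lin_ext_cong [fundef_cong]:
  "\<lbrakk>p = q; \<And>b. b \<in> Poly_Mapping.keys q \<Longrightarrow> f b = g b\<rbrakk> \<Longrightarrow> lin_ext f p = lin_ext g q"
  by (simp add: lin_ext_def)

text \<open>The degree guard makes the recursion terminate. On the terms of a coproduct it discards
  exactly the cut \<open>{}\<close>, by \<open>degree_restrict_less_iff\<close>.\<close>

function conv_left_inverse :: "bool \<Rightarrow> (dqp \<Rightarrow> 'k::field H_dqp) \<Rightarrow> dqp \<Rightarrow> 'k H_dqp" where
  "conv_left_inverse s f a = conv_unit a -
    lin_ext (\<lambda>p. if dqp_degree (fst p) < dqp_degree a
      then H_mult (conv_left_inverse s f (fst p)) (f (snd p)) else 0) (dqp_cut s a)"
  by auto
termination by (relation "measure (\<lambda>(s, f, a). dqp_degree a)") auto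

declare conv_left_inverse.simps [simp del]

lemma degree_restrict:
  assumes "double_quasi_poset P"
  shows "dqp_degree (iso_class (dqs_restrict P X)) = card (verts P \<inter> X)"
  using assms by (simp add: dqp_degree_iso_class double_quasi_poset_restrict)

lemma degree_restrict_less_iff:
  assumes P: "double_quasi_poset P" and X: "X \<subseteq> verts P"
  shows "dqp_degree (iso_class (dqs_restrict P (verts P - X))) < dqp_degree (iso_class P) \<longleftrightarrow> X \<noteq> {}"
proof -
  have "finite (verts P)" using P by (simp add: double_quasi_poset_def)
  moreover have "verts P \<inter> (verts P - X) = verts P - X" by blast
  ultimately show ?thesis
    using X by (auto simp: degree_restrict dqp_degree_iso_class P intro!: psubset_card_mono)
qed

text \<open>Once the guard is read as \<open>X\<close> being nonempty, the recursion is the equation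
  of \<open>convolution_split\<close> solved for its leading term.\<close>

lemma conv_left_inverse:
  assumes f: "f dqp_empty = H_one"
  shows "convolution s (conv_left_inverse s f) f = conv_unit"
proof
  fix a
  obtain P :: "nat dqs" where P: "double_quasi_poset P" and a: "a = iso_class P"
    by (rule iso_class_exhaust)
  let ?g = "conv_left_inverse s f"
  let ?h = "\<lambda>X. H_mult (?g (iso_class (dqs_restrict P (verts P - X)))) (f (iso_class (dqs_restrict P X)))"
  have "?g a = conv_unit a - (\<Sum>X\<in>cuts s P. if X \<noteq> {} then ?h X else 0)"
    unfolding conv_left_inverse.simps[of s f a]
    using cuts_subset[of _ s P] by (simp add: a dqp_cut_iso_class P lin_ext_sum degree_restrict_less_iff
        cong: if_cong)
  also have "(\<Sum>X\<in>cuts s P. if X \<noteq> {} then ?h X else 0) = (\<Sum>X\<in>cuts s P - {{}}. ?h X)"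
    by (rule sum.mono_neutral_cong_right) (auto simp: finite_cuts P)
  finally show "convolution s ?g f a = conv_unit a"
    using convolution_split[where f = f and g = ?g and s = s, OF P f] by (simp add: a)
qed

text \<open>In degree 0 the guard fails and only the unit remains. The left inverse therefore meets
  the normalization needed to be inverted in turn.\<close>

lemma conv_left_inverse_empty:
  assumes "f dqp_empty = H_one"
  shows "conv_left_inverse s f dqp_empty = H_one"
  by (simp add: conv_left_inverse.simps[of s f dqp_empty] conv_unit_def dqp_cut_empty
      dqp_degree_eq_0_iff[THEN iffD2])

text \<open>A left inverse \<open>g\<close> of \<open>f\<close> has itself a left inverse \<open>h\<close>, and \<open>h = h * (g * f) = f\<close>.\<close>

lemma conv_right_inverse:
  assumes f: "f dqp_empty = H_one"
  shows "convolution s f (conv_left_inverse s f) = conv_unit"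
proof -
  let ?g = "conv_left_inverse s f"
  let ?h = "conv_left_inverse s ?g"
  have hg: "convolution s ?h ?g = conv_unit"
    by (rule conv_left_inverse[where f = ?g, OF conv_left_inverse_empty[where f = f, OF f]])
  have "?h = convolution s ?h (convolution s ?g f)"
    by (simp add: conv_left_inverse[where f = f, OF f] convolution_unit)
  also have "\<dots> = f" by (simp add: hg convolution_unit flip: convolution_assoc)
  finally show ?thesis using hg by simp
qed

section \<open>Antipodes as convolution inverses\<close>

lemma linear_mult_lin: "linear_map (mult_lin m)"
  unfolding mult_lin_def by (rule linear_lin_ext)

lemma mult_lin_tensor_map_cut:
  "mult_lin H_mult (tensor_map F G (H_cut s (basis_vec a))) =
    convolution s (\<lambda>b. F (basis_vec b)) (\<lambda>b. G (basis_vec b)) a"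
proof (cases a rule: iso_class_exhaust)
  case (1 P)
  then show ?thesis
    by (simp add: dqp_cut_iso_class convolution_iso_class linear_sum[OF linear_tensor_map]
        linear_sum[OF linear_mult_lin] mult_lin_tensor)
qed

lemma basis_vec_empty: "basis_vec dqp_empty = H_one"
  by (simp add: H_one_def)

lemma conv_unit_eq: "vscale (H_counit (basis_vec a)) H_one = conv_unit a"
  by (simp add: H_counit_basis conv_unit_def)

lemma linear_counit_one: "linear_map (\<lambda>x. vscale (H_counit x) H_one)"
  by unfold_locales
    (simp_all add: H_counit_def lookup_add lookup_vscale vs.scale_left_distrib)

text \<open>Both antipode equations are linear in their argument, so they may be tested on classes,
  where \<open>mult_lin_tensor_map_cut\<close> turns them into convolution equations.\<close>

lemma is_antipode_iff_convolution:
  "is_antipode H_mult H_one (H_cut s) H_counit S \<longleftrightarrow> linear_map S \<and>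
    convolution s (\<lambda>b. S (basis_vec b)) basis_vec = conv_unit \<and>
    convolution s basis_vec (\<lambda>b. S (basis_vec b)) = conv_unit" (is "?L \<longleftrightarrow> ?R")
proof
  assume L: ?L
  have "mult_lin H_mult (tensor_map S id (H_cut s (basis_vec a))) = conv_unit a"
    "mult_lin H_mult (tensor_map id S (H_cut s (basis_vec a))) = conv_unit a" for a
    using L unfolding is_antipode_def conv_unit_eq[symmetric] by blast+
  then show ?R using L by (simp add: is_antipode_def fun_eq_iff mult_lin_tensor_map_cut del: H_cut_basis)
next
  assume R: ?R
  have L: "linear_map (\<lambda>x. mult_lin H_mult (tensor_map F G (H_cut s x)))" for F G :: "'a H_dqp \<Rightarrow> 'a H_dqp"
    by (rule linear_map_comp[OF linear_map_comp[OF linear_H_cut linear_tensor_map] linear_mult_lin])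
  have 1: "mult_lin H_mult (tensor_map S id (H_cut s x)) = vscale (H_counit x) H_one" for x
    by (rule linear_eqI[OF L linear_counit_one]) (use R in \<open>simp only: mult_lin_tensor_map_cut id_apply conv_unit_eq\<close>)
  have 2: "mult_lin H_mult (tensor_map id S (H_cut s x)) = vscale (H_counit x) H_one" for x
    by (rule linear_eqI[OF L linear_counit_one]) (use R in \<open>simp only: mult_lin_tensor_map_cut id_apply conv_unit_eq\<close>)
  show ?L unfolding is_antipode_def using R 1 2 by blast
qed

theorem hopf_algebra_H_cut: "hopf_algebra H_mult (H_one :: 'k::field H_dqp) (H_cut s) H_counit"
proof -
  let ?g = "conv_left_inverse s (basis_vec :: dqp \<Rightarrow> 'k H_dqp)"
  have "is_antipode H_mult H_one (H_cut s) H_counit (lin_ext ?g)"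
    by (simp add: is_antipode_iff_convolution linear_lin_ext conv_left_inverse conv_right_inverse
        basis_vec_empty)
  then show ?thesis
    unfolding hopf_algebra_def hopf_algebra_axioms_def using bialgebra_H_cut by blast
qed

text \<open>The left antipode equation with the cut \<open>{}\<close> isolated. It is stated for an
  arbitrary antipode because the grading must be respected by every one.\<close>

lemma antipode_recursion:
  assumes S: "is_antipode H_mult H_one (H_cut s) H_counit S" and P: "double_quasi_poset P"
  shows "S (basis_vec (iso_class P)) = conv_unit (iso_class P) - (\<Sum>X\<in>cuts s P - {{}}.
    H_mult (S (basis_vec (iso_class (dqs_restrict P (verts P - X))))) (basis_vec (iso_class (dqs_restrict P X))))"
  using S convolution_split[OF P, of basis_vec s "\<lambda>b. S (basis_vec b)"]
  by (simp add: is_antipode_iff_convolution basis_vec_empty algebra_simps)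

text \<open>The induction scheme that fits \<open>antipode_recursion\<close>: removing a nonempty
  set of vertices lowers the degree.\<close>

lemma degree_restrict_induct [case_names step]:
  assumes "\<And>P :: nat dqs. \<lbrakk>double_quasi_poset P;
    \<And>X. \<lbrakk>X \<subseteq> verts P; X \<noteq> {}\<rbrakk> \<Longrightarrow> R (iso_class (dqs_restrict P (verts P - X)))\<rbrakk> \<Longrightarrow> R (iso_class P)"
  shows "R a"
proof (induction "dqp_degree a" arbitrary: a rule: less_induct)
  case less
  obtain P :: "nat dqs" where P: "double_quasi_poset P" and a: "a = iso_class P"
    by (rule iso_class_exhaust)
  show ?case unfolding a by (rule assms[OF P less]) (simp_all add: a P degree_restrict_less_iff)
qed

section \<open>Subalgebras spanned by hereditary classes\<close>

text \<open>Products and restrictions give stability under multiplication and coproduct; the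
  antipode recursion uses all three conditions.\<close>

definition hereditary :: "(dqp \<Rightarrow> bool) \<Rightarrow> bool" where
  "hereditary Q \<longleftrightarrow> Q dqp_empty \<and> (\<forall>a b. Q a \<longrightarrow> Q b \<longrightarrow> Q (dqp_prod a b)) \<and>
    (\<forall>(P :: nat dqs) X. double_quasi_poset P \<longrightarrow> Q (iso_class P) \<longrightarrow> Q (iso_class (dqs_restrict P X)))"

lemma hereditary_special: "hereditary dqp_special"
  unfolding hereditary_def
proof (intro conjI allI impI)
  show "dqp_special dqp_empty"
    by (simp add: dqp_empty_eq_iso_class dqp_special_iso_class double_quasi_poset_empty)
      (simp add: dqs_special_def dqs_empty_def)
  show "dqp_special (dqp_prod a b)" if "dqp_special a" "dqp_special b" for a b
  proof (cases a rule: iso_class_exhaust; cases b rule: iso_class_exhaust)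
    fix P Q :: "nat dqs"
    assume D: "double_quasi_poset P" "double_quasi_poset Q" and ab: "a = iso_class P" "b = iso_class Q"
    then have "dqs_special P" "dqs_special Q" using that by (simp_all add: dqp_special_iso_class)
    \<comment> \<open>Points of different factors are comparable through the cross pairs of
      \<open>le2\<close>.\<close>
    then have "x \<in> verts (dqs_prod P Q) \<Longrightarrow> y \<in> verts (dqs_prod P Q) \<Longrightarrow> x \<noteq> y \<Longrightarrow>
        (x, y) \<in> le2 (dqs_prod P Q) \<or> (y, x) \<in> le2 (dqs_prod P Q)" for x y
      by (cases x; cases y) (auto simp: dqs_special_def total_on_def)
    then have "dqs_special (dqs_prod P Q)" by (simp add: dqs_special_def total_on_def)
    then show ?thesis
      using D by (simp add: ab dqp_prod_iso_class dqp_special_iso_class double_quasi_poset_prod)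
  qed
  show "dqp_special (iso_class (dqs_restrict P X))"
    if "double_quasi_poset P" "dqp_special (iso_class P)" for P :: "nat dqs" and X
    using that by (simp add: dqp_special_iso_class double_quasi_poset_restrict)
      (auto simp: dqs_special_def total_on_def dqs_restrict_def)
qed

lemma hereditary_trivial: "hereditary dqp_trivial"
  unfolding hereditary_def
proof (intro conjI allI impI)
  show "dqp_trivial dqp_empty"
    by (simp add: dqp_empty_eq_iso_class dqp_trivial_iso_class double_quasi_poset_empty)
      (simp add: dqs_trivial_def dqs_empty_def)
  show "dqp_trivial (dqp_prod a b)" if "dqp_trivial a" "dqp_trivial b" for a b
  proof (cases a rule: iso_class_exhaust; cases b rule: iso_class_exhaust)
    fix P Q :: "nat dqs"
    assume D: "double_quasi_poset P" "double_quasi_poset Q" and ab: "a = iso_class P" "b = iso_class Q"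
    then have "dqs_trivial P" "dqs_trivial Q" using that by (simp_all add: dqp_trivial_iso_class)
    then have "x \<in> verts (dqs_prod P Q) \<Longrightarrow> y \<in> verts (dqs_prod P Q) \<Longrightarrow> x \<noteq> y \<Longrightarrow>
        (x, y) \<notin> le1 (dqs_prod P Q)" for x y
      by (cases x; cases y) (auto simp: dqs_trivial_def)
    then have "dqs_trivial (dqs_prod P Q)" by (simp add: dqs_trivial_def)
    then show ?thesis
      using D by (simp add: ab dqp_prod_iso_class dqp_trivial_iso_class double_quasi_poset_prod)
  qed
  show "dqp_trivial (iso_class (dqs_restrict P X))"
    if "double_quasi_poset P" "dqp_trivial (iso_class P)" for P :: "nat dqs" and X
    using that by (simp add: dqp_trivial_iso_class double_quasi_poset_restrict)
      (auto simp: dqs_trivial_def dqs_restrict_def)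
qed

lemma dqs_double_poset_iff:
  "double_quasi_poset P \<Longrightarrow> dqs_double_poset P \<longleftrightarrow> antisym (le1 P) \<and> antisym (le2 P)"
  by (auto simp: dqs_double_poset_def double_quasi_poset_def partial_order_on_def)

lemma hereditary_double_poset: "hereditary dqp_double_poset"
  unfolding hereditary_def
proof (intro conjI allI impI)
  show "dqp_double_poset dqp_empty"
    by (simp add: dqp_empty_eq_iso_class dqp_double_poset_iso_class double_quasi_poset_empty
        dqs_double_poset_iff) (simp add: dqs_empty_def)
  show "dqp_double_poset (dqp_prod a b)" if "dqp_double_poset a" "dqp_double_poset b" for a b
  proof (cases a rule: iso_class_exhaust; cases b rule: iso_class_exhaust)
    fix P Q :: "nat dqs"
    assume D: "double_quasi_poset P" "double_quasi_poset Q" and ab: "a = iso_class P" "b = iso_class Q"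
    then have "antisym (le1 P)" "antisym (le2 P)" "antisym (le1 Q)" "antisym (le2 Q)"
      using that by (simp_all add: dqp_double_poset_iso_class dqs_double_poset_iff)
    \<comment> \<open>The cross pairs of \<open>le2\<close> run in one direction only, so they
      create no two-way comparison.\<close>
    then have "antisym (le1 (dqs_prod P Q))" "antisym (le2 (dqs_prod P Q))"
      by (auto simp: antisym_def dqs_prod_def)
    then show ?thesis
      using D by (simp add: ab dqp_prod_iso_class dqp_double_poset_iso_class double_quasi_poset_prod
          dqs_double_poset_iff)
  qed
  show "dqp_double_poset (iso_class (dqs_restrict P X))"
    if "double_quasi_poset P" "dqp_double_poset (iso_class P)" for P :: "nat dqs" and X
    using that by (simp add: dqp_double_poset_iso_class double_quasi_poset_restrict dqs_double_poset_iff)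
      (auto simp: dqs_restrict_def antisym_def)
qed

lemma H_mult_coordinate_subspace:
  assumes "\<And>a b. \<lbrakk>Q a; R b\<rbrakk> \<Longrightarrow> T (dqp_prod a b)"
    and "x \<in> vs.span {basis_vec a | a. Q a}" "y \<in> vs.span {basis_vec b | b. R b}"
  shows "H_mult x y \<in> vs.span {basis_vec a | a. T a}"
  unfolding H_mult_def using assms
  by (intro bilin_ext_coordinate_subspace[where Q = Q and R = R])
    (auto intro: basis_vec_in_coordinate_subspace vs.subspace_span)

lemma conv_unit_in: "\<lbrakk>vs.subspace V; a = dqp_empty \<Longrightarrow> H_one \<in> V\<rbrakk> \<Longrightarrow> conv_unit a \<in> V"
  by (auto simp: conv_unit_def vs.subspace_0)

lemma hopf_subalgebra_hereditary:
  assumes Q: "hereditary Q"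
  shows "hopf_subalgebra H_mult (H_one :: 'k::field H_dqp) (H_cut s) H_counit (vs.span {basis_vec a | a. Q a})"
    (is "hopf_subalgebra _ _ _ _ ?B")
proof -
  have Q1: "Q dqp_empty" and Q2: "\<And>a b. \<lbrakk>Q a; Q b\<rbrakk> \<Longrightarrow> Q (dqp_prod a b)"
    and Q3: "\<And>(P :: nat dqs) X. \<lbrakk>double_quasi_poset P; Q (iso_class P)\<rbrakk> \<Longrightarrow> Q (iso_class (dqs_restrict P X))"
    using Q unfolding hereditary_def by blast+
  have sub: "vs.subspace ?B" by (rule vs.subspace_span)
  have one: "H_one \<in> ?B" unfolding H_one_def by (rule basis_vec_in_coordinate_subspace[of Q, OF Q1])
  have mult: "H_mult x y \<in> ?B" if "x \<in> ?B" "y \<in> ?B" for x y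
    using H_mult_coordinate_subspace[of Q Q Q] Q2 that by blast
  have cut: "H_cut s x \<in> tensor_subspace ?B ?B" if "x \<in> ?B" for x
  proof (rule linear_image_span[OF linear_H_cut _ _ that])
    show "vs.subspace (tensor_subspace ?B ?B)" unfolding tensor_subspace_def by (rule vs.subspace_span)
    fix a assume a: "Q a"
    have "basis_vec (b, c) \<in> tensor_subspace ?B ?B" if "Q b" "Q c" for b c
      unfolding tensor_subspace_def tensor_basis[symmetric]
      using basis_vec_in_coordinate_subspace[of Q] that by (intro vs.span_base) blast
    moreover obtain P :: "nat dqs" where "double_quasi_poset P" "a = iso_class P"
      by (rule iso_class_exhaust)
    ultimately show "H_cut s (basis_vec a) \<in> tensor_subspace ?B ?B"
      using Q3 a unfolding tensor_subspace_def
      by (auto simp: dqp_cut_iso_class intro!: vs.span_sum)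
  qed
  obtain S where S: "is_antipode H_mult (H_one :: 'k H_dqp) (H_cut s) H_counit S"
    using hopf_algebra.antipode_exists[OF hopf_algebra_H_cut] by blast
  \<comment> \<open>\<open>Q\<close> belongs to the induction statement: it passes to complements of
    cuts, so the hypothesis applies to each of the smaller values of \<open>S\<close> in the
    recursion.\<close>
  have "Q a \<Longrightarrow> S (basis_vec a) \<in> ?B" for a
  proof (induction a rule: degree_restrict_induct)
    case (step P)
    show ?case
      unfolding antipode_recursion[OF S step(1)]
    proof (intro vs.span_diff vs.span_sum)
      show "conv_unit (iso_class P) \<in> ?B" by (rule conv_unit_in[OF sub one])
      fix X assume X: "X \<in> cuts s P - {{}}"
      have "S (basis_vec (iso_class (dqs_restrict P (verts P - X)))) \<in> ?B"
        using X cuts_subset[of X s P] step Q3 by blast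
      moreover have "basis_vec (iso_class (dqs_restrict P X)) \<in> ?B"
        by (rule basis_vec_in_coordinate_subspace[of Q]) (rule Q3[OF step(1,3)])
      ultimately show "H_mult (S (basis_vec (iso_class (dqs_restrict P (verts P - X)))))
          (basis_vec (iso_class (dqs_restrict P X))) \<in> ?B" by (rule mult)
    qed
  qed
  then have "S x \<in> ?B" if "x \<in> ?B" for x
    using linear_image_span[of S ?B Q] S sub that by (simp add: is_antipode_def)
  then show ?thesis
    unfolding hopf_subalgebra_def using hopf_algebra_H_cut sub one mult cut S by blast
qed

section \<open>The grading\<close>

definition component :: "nat \<Rightarrow> 'k::field H_dqp \<Rightarrow> 'k H_dqp" where
  "component n = lin_ext (\<lambda>a. if dqp_degree a = n then basis_vec a else 0)"

lemma lookup_component: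
  "Poly_Mapping.lookup (component n x) a = (if dqp_degree a = n then Poly_Mapping.lookup x a else 0)"
proof -
  have "Poly_Mapping.lookup (component n x) a = (\<Sum>b\<in>Poly_Mapping.keys x.
      if b = a then (if dqp_degree a = n then Poly_Mapping.lookup x a else 0) else 0)"
    unfolding component_def lin_ext_def lookup_sum lookup_vscale
    by (intro sum.cong) (auto simp: lookup_single when_def)
  then show ?thesis by (simp add: in_keys_iff)
qed

lemma H_homogeneous_iff: "x \<in> H_homogeneous n \<longleftrightarrow> (\<forall>a\<in>Poly_Mapping.keys x. dqp_degree a = n)"
  unfolding H_homogeneous_def coordinate_subspace_eq by simp

lemma vector_space_grading_H_homogeneous:
  "vector_space_grading (H_homogeneous :: nat \<Rightarrow> 'k::field H_dqp set)"
  unfolding vector_space_grading_def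
proof (intro conjI allI)
  show "vs.subspace (H_homogeneous n :: 'k H_dqp set)" for n
    unfolding H_homogeneous_def by (rule vs.subspace_span)
  fix x :: "'k H_dqp"
  show "\<exists>!c. finite {n. c n \<noteq> 0} \<and> (\<forall>n. c n \<in> H_homogeneous n) \<and> x = (\<Sum>n | c n \<noteq> 0. c n)"
  proof (rule ex1I)
    let ?c = "\<lambda>n. component n x"
    \<comment> \<open>A nonzero component has a key, necessarily of degree \<open>n\<close>, and
      \<open>x\<close> has finitely many keys.\<close>
    have "{n. ?c n \<noteq> 0} \<subseteq> dqp_degree ` Poly_Mapping.keys x"
    proof
      fix n assume "n \<in> {n. ?c n \<noteq> 0}"
      then obtain a where "Poly_Mapping.lookup (?c n) a \<noteq> 0"
        using poly_mapping_eqI[of "?c n" 0] by auto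
      then show "n \<in> dqp_degree ` Poly_Mapping.keys x"
        by (auto simp: lookup_component in_keys_iff split: if_splits)
    qed
    then have fin: "finite {n. ?c n \<noteq> 0}" by (rule finite_subset) simp
    moreover have "?c n \<in> H_homogeneous n" for n
      by (auto simp: H_homogeneous_iff in_keys_iff lookup_component split: if_splits)
    moreover have "x = (\<Sum>n | ?c n \<noteq> 0. ?c n)"
    proof (rule poly_mapping_eqI)
      fix a
      have "Poly_Mapping.lookup (?c (dqp_degree a)) a = Poly_Mapping.lookup x a"
        by (simp add: lookup_component)
      moreover have "Poly_Mapping.lookup (\<Sum>n | ?c n \<noteq> 0. ?c n) a =
          (\<Sum>n | ?c n \<noteq> 0. if n = dqp_degree a then Poly_Mapping.lookup x a else 0)"
        unfolding lookup_sum by (intro sum.cong) (auto simp: lookup_component)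
      ultimately show "Poly_Mapping.lookup x a = Poly_Mapping.lookup (\<Sum>n | ?c n \<noteq> 0. ?c n) a"
        using fin by auto
    qed
    ultimately show "finite {n. ?c n \<noteq> 0} \<and> (\<forall>n. ?c n \<in> H_homogeneous n) \<and> x = (\<Sum>n | ?c n \<noteq> 0. ?c n)"
      by blast
  next
    fix d :: "nat \<Rightarrow> 'k H_dqp"
    assume d: "finite {n. d n \<noteq> 0} \<and> (\<forall>n. d n \<in> H_homogeneous n) \<and> x = (\<Sum>n | d n \<noteq> 0. d n)"
    have *: "Poly_Mapping.lookup (d n) a = 0" if "dqp_degree a \<noteq> n" for n a
      using d that by (metis H_homogeneous_iff in_keys_iff)
    \<comment> \<open>Uniqueness: only the summand in the degree of \<open>a\<close> can have a
      coefficient at \<open>a\<close>, so \<open>x\<close> determines the whole family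
      \<open>d\<close>.\<close>
    have "Poly_Mapping.lookup x a = Poly_Mapping.lookup (d (dqp_degree a)) a" for a
    proof -
      have "Poly_Mapping.lookup x a = (\<Sum>n | d n \<noteq> 0. Poly_Mapping.lookup (d n) a)"
        using d lookup_sum by metis
      also have "\<dots> = (\<Sum>n | d n \<noteq> 0. if n = dqp_degree a then Poly_Mapping.lookup (d n) a else 0)"
        using * by (intro sum.cong) auto
      also have "\<dots> = Poly_Mapping.lookup (d (dqp_degree a)) a" using d by auto
      finally show ?thesis .
    qed
    then show "d = (\<lambda>n. component n x)"
      using * by (auto intro!: poly_mapping_eqI simp: lookup_component fun_eq_iff)
  qed
qed

theorem graded_connected_H_cut:
  "graded_connected_hopf_algebra H_mult (H_one :: 'k::field H_dqp) (H_cut s) H_counit H_homogeneous"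
proof -
  let ?G = "H_homogeneous :: nat \<Rightarrow> 'k H_dqp set"
  have sub: "vs.subspace (?G n)" for n unfolding H_homogeneous_def by (rule vs.subspace_span)
  have bas: "basis_vec a \<in> ?G (dqp_degree a)" for a by (simp add: H_homogeneous_iff)
  have mult: "H_mult x y \<in> ?G (i + j)" if "x \<in> ?G i" "y \<in> ?G j" for x y i j
    using H_mult_coordinate_subspace[of "\<lambda>a. dqp_degree a = i" "\<lambda>a. dqp_degree a = j" "\<lambda>a. dqp_degree a = i + j"]
      that by (simp add: H_homogeneous_def dqp_degree_prod)
  have one: "H_one \<in> ?G 0"
    using bas[of dqp_empty] by (simp add: H_one_def dqp_degree_eq_0_iff[THEN iffD2])
  have card: "card (verts P - X) + card X = card (verts P)" if "double_quasi_poset P" "X \<subseteq> verts P" for P :: "nat dqs" and X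
    using that by (metis card_Diff_subset card_mono double_quasi_poset_def finite_subset le_add_diff_inverse2)
  have cut: "H_cut s x \<in> vs.span (\<Union>i\<le>n. tensor_subspace (?G i) (?G (n - i)))" (is "_ \<in> ?T")
    if "x \<in> ?G n" for x n
  proof (rule linear_image_span[OF linear_H_cut vs.subspace_span _ that[unfolded H_homogeneous_def]])
    fix a assume n: "dqp_degree a = n"
    obtain P :: "nat dqs" where P: "double_quasi_poset P" and a: "a = iso_class P"
      by (rule iso_class_exhaust)
    have "basis_vec (iso_class (dqs_restrict P (verts P - X)), iso_class (dqs_restrict P X)) \<in> ?T"
      (is "basis_vec (?b, ?c) \<in> _") if "X \<in> cuts s P" for X
    proof -
      have X: "X \<subseteq> verts P" using that by (rule cuts_subset)
      then have "verts P \<inter> (verts P - X) = verts P - X" "verts P \<inter> X = X" by auto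
      \<comment> \<open>A cut and its complement partition the vertices; the term therefore lies in
        the summand indexed by the degree of \<open>?b\<close>.\<close>
      then have "dqp_degree ?b + dqp_degree ?c = n"
        using card[OF P X] n P by (simp add: degree_restrict a dqp_degree_iso_class)
      then have "dqp_degree ?b \<le> n" "dqp_degree ?c = n - dqp_degree ?b" by auto
      moreover have "basis_vec (?b, ?c) \<in> tensor_subspace (?G (dqp_degree ?b)) (?G (dqp_degree ?c))"
        unfolding tensor_subspace_def tensor_basis[symmetric] using bas by (intro vs.span_base) blast
      ultimately show ?thesis by (intro vs.span_base) auto
    qed
    then show "H_cut s (basis_vec a) \<in> ?T"
      by (simp add: a dqp_cut_iso_class P vs.span_sum)
  qed
  have counit: "H_counit x = 0" if "x \<in> ?G n" "n \<noteq> 0" for x n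
    using that dqp_degree_eq_0_iff[of dqp_empty]
    by (metis H_homogeneous_iff H_counit_def in_keys_iff)
  have antipode: "S x \<in> ?G n"
    if S: "is_antipode H_mult (H_one :: 'k H_dqp) (H_cut s) H_counit S" and "x \<in> ?G n" for S x n
  proof -
    have "S (basis_vec a) \<in> ?G (dqp_degree a)" for a
    proof (induction a rule: degree_restrict_induct)
      case (step P)
      show ?case
        unfolding antipode_recursion[OF S step(1)]
      proof (intro vs.subspace_diff vs.subspace_sum sub)
        show "conv_unit (iso_class P) \<in> ?G (dqp_degree (iso_class P))"
          by (rule conv_unit_in[OF sub]) (use one dqp_degree_eq_0_iff[of dqp_empty] in simp)
        fix X assume X: "X \<in> cuts s P - {{}}"
        then have V: "X \<subseteq> verts P" "X \<noteq> {}" using cuts_subset[of X s P] by auto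
        then have "verts P \<inter> (verts P - X) = verts P - X" "verts P \<inter> X = X" by auto
        then have "dqp_degree (iso_class (dqs_restrict P (verts P - X))) + dqp_degree (iso_class (dqs_restrict P X))
            = dqp_degree (iso_class P)"
          using card[OF step(1) V(1)] step(1) by (simp add: degree_restrict dqp_degree_iso_class)
        then show "H_mult (S (basis_vec (iso_class (dqs_restrict P (verts P - X)))))
          (basis_vec (iso_class (dqs_restrict P X))) \<in> ?G (dqp_degree (iso_class P))"
          using mult[OF step(2)[OF V] bas] by metis
      qed
    qed
    then show ?thesis
      using linear_image_span[of S "?G n" "\<lambda>a. dqp_degree a = n" x] S sub that(2)
      by (auto simp: is_antipode_def H_homogeneous_def)
  qed
  \<comment> \<open>The empty class is the only one of degree 0, so its basis vector alone spans
    this piece.\<close>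
  have "vs.dim (?G 0) = card {basis_vec dqp_empty :: 'k H_dqp}"
  proof (rule vs.dim_eq_card)
    show "vs.span {basis_vec dqp_empty} = vs.span (?G 0)"
      by (simp add: H_homogeneous_def dqp_degree_eq_0_iff vs.span_span)
    show "vs.independent {basis_vec dqp_empty :: 'k H_dqp}"
      by (metis lookup_single_eq lookup_zero one_neq_zero vs.dependent_single)
  qed
  then have dim: "vs.dim (?G 0) = 1" by simp
  show ?thesis
    unfolding graded_connected_hopf_algebra_def graded_hopf_algebra_def graded_hopf_algebra_axioms_def
      graded_connected_hopf_algebra_axioms_def
    using hopf_algebra_H_cut vector_space_grading_H_homogeneous mult one cut counit antipode dim
    by blast
qed

section \<open>The splitting morphism\<close>

lemma linear_H_pos: "linear_map H_pos"
  unfolding H_pos_def by (rule linear_lin_ext)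

lemma H_pos_basis [simp]: "H_pos (basis_vec a) = basis_vec (dqp_pos a)"
  by (simp add: H_pos_def)

lemma H_pos_one [simp]: "H_pos H_one = H_one"
proof -
  have "dqp_pos dqp_empty = dqp_empty" by simp
  then show ?thesis by (simp only: H_one_def H_pos_basis)
qed

lemma H_pos_in_dp: "H_pos x \<in> H_dp"
proof -
  \<comment> \<open>Writing the whole space as a coordinate subspace makes
    \<open>linear_image_span\<close> applicable to every \<open>x\<close>.\<close>
  have "x \<in> vs.span {basis_vec a | a. True}" by (simp only: coordinate_subspace_eq) simp
  then show ?thesis
    unfolding H_dp_def
    by (rule linear_image_span[OF linear_H_pos vs.subspace_span, rotated])
      (simp add: basis_vec_in_coordinate_subspace[of dqp_double_poset] dqp_double_poset_pos)
qed

lemma H_pos_eq_self: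
  assumes "x \<in> H_dp"
  shows "H_pos x = x"
proof -
  have "dqp_pos a = a" if "a \<in> Poly_Mapping.keys x" for a
    using assms that unfolding H_dp_def coordinate_subspace_eq by (simp add: dqp_pos_double_poset)
  then have "H_pos x = lin_ext basis_vec x" unfolding H_pos_def by (intro lin_ext_cong) simp_all
  then show ?thesis by (simp add: lin_ext_basis)
qed

lemma H_pos_mult: "H_pos (H_mult x y) = H_mult (H_pos x) (H_pos y)"
proof -
  have "H_pos (H_mult (basis_vec a) y) = H_mult (H_pos (basis_vec a)) (H_pos y)" for a y
    by (rule linear_eqI[OF linear_map_comp[OF linear_H_mult_right linear_H_pos]
          linear_map_comp[OF linear_H_pos linear_H_mult_right]]) (simp add: dqp_pos_prod)
  then show ?thesis
    by (rule linear_eqI[where F = "\<lambda>x. H_pos (H_mult x y)" and G = "\<lambda>x. H_mult (H_pos x) (H_pos y)",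
          OF linear_map_comp[OF linear_H_mult_left linear_H_pos]
            linear_map_comp[OF linear_H_pos linear_H_mult_left]])
qed

section \<open>Splitting against coproducts, counit and antipodes\<close>

lemma verts_pos [simp]: "verts (dqs_pos P) = verts P"
  by (simp add: dqs_pos_def)

lemma dqp_pos_restrict:
  "double_quasi_poset P \<Longrightarrow>
    iso_class (dqs_restrict (dqs_pos P) X) = dqp_pos (iso_class (dqs_restrict P X))"
  by (simp add: restrict_pos dqp_pos_iso_class double_quasi_poset_restrict)

lemma H_cut_pos:
  fixes x :: "'k::field H_dqp"
  shows "H_cut False (H_pos x) = tensor_map H_pos H_pos (H_cut True x)"
proof (rule linear_eqI[where F = "\<lambda>x. H_cut False (H_pos x)",
      OF linear_map_comp[OF linear_H_pos linear_H_cut] linear_map_comp[OF linear_H_cut linear_tensor_map]])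
  fix a
  obtain P :: "nat dqs" where P: "double_quasi_poset P" and a: "a = iso_class P"
    by (rule iso_class_exhaust)
  \<comment> \<open>\<open>cuts_pos\<close> identifies the two index sets, and
    \<open>dqp_pos_restrict\<close> the two tensor factors of each term.\<close>
  show "H_cut False (H_pos (basis_vec a) :: 'k H_dqp) = tensor_map H_pos H_pos (H_cut True (basis_vec a))"
    using P by (simp add: a dqp_cut_iso_class linear_sum[OF linear_tensor_map] dqp_pos_iso_class
        double_quasi_poset_pos cuts_pos flip: dqp_pos_restrict)
qed

lemma H_counit_pos: "H_counit (H_pos x) = H_counit x"
proof -
  have "linear_form (\<lambda>x :: 'a H_dqp. H_counit (H_pos x))"
    unfolding H_pos_def by unfold_locales
      (simp_all add: H_counit_def lin_ext_add lin_ext_vscale lookup_add lookup_vscale algebra_simps)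
  then show ?thesis
    by (rule linear_form_eqI[where F = "\<lambda>x. H_counit (H_pos x)", OF _ linear_H_counit])
      (simp add: H_counit_basis)
qed

text \<open>The recursions for \<open>S\<close> at \<open>P\<close> and for \<open>S'\<close> at its
  splitting run over the same cuts, and \<open>H_pos\<close> carries one into the other term by
  term.\<close>

lemma H_pos_antipode:
  assumes S: "is_antipode H_mult H_one (H_cut True) H_counit S"
    and S': "is_antipode H_mult H_one (H_cut False) H_counit S'"
  shows "H_pos (S x) = S' (H_pos x)"
proof -
  have lin: "linear_map S" "linear_map S'" using S S' by (simp_all add: is_antipode_def)
  have "H_pos (S (basis_vec a)) = S' (basis_vec (dqp_pos a))" for a
  proof (induction a rule: degree_restrict_induct)
    case (step P)
    note P = step(1)
    have unit: "H_pos (conv_unit (iso_class P)) = conv_unit (dqp_pos (iso_class P))"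
      by (simp add: conv_unit_def linear_zero[OF linear_H_pos])
    have "H_pos (S (basis_vec (iso_class P))) = conv_unit (dqp_pos (iso_class P)) -
        (\<Sum>X\<in>cuts True P - {{}}. H_mult (H_pos (S (basis_vec (iso_class (dqs_restrict P (verts P - X))))))
          (basis_vec (dqp_pos (iso_class (dqs_restrict P X)))))"
      unfolding antipode_recursion[OF S P]
      by (simp add: linear_diff[OF linear_H_pos] linear_sum[OF linear_H_pos] H_pos_mult unit)
    also have "\<dots> = conv_unit (dqp_pos (iso_class P)) -
        (\<Sum>X\<in>cuts True P - {{}}. H_mult (S' (basis_vec (dqp_pos (iso_class (dqs_restrict P (verts P - X))))))
          (basis_vec (dqp_pos (iso_class (dqs_restrict P X)))))"
      using step(2) cuts_subset[of _ True P] by (intro arg_cong2[where f = minus] sum.cong) auto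
    \<comment> \<open>The recursion of \<open>S'\<close> at \<open>dqs_pos P\<close>, read
      backwards.\<close>
    also have "\<dots> = S' (basis_vec (dqp_pos (iso_class P)))"
      using antipode_recursion[OF S' double_quasi_poset_pos[OF P]] P
      by (simp add: cuts_pos dqp_pos_restrict dqp_pos_iso_class)
    finally show ?case .
  qed
  then show ?thesis
    unfolding H_pos_basis[symmetric]
    by (rule linear_eqI[where F = "\<lambda>x. H_pos (S x)" and G = "\<lambda>x. S' (H_pos x)",
          OF linear_map_comp[OF lin(1) linear_H_pos] linear_map_comp[OF linear_H_pos lin(2)]])
qed

theorem theorem10:
  shows
    "graded_connected_hopf_algebra H_mult (H_one :: 'k::field H_dqp) H_comult H_counit H_homogeneous
     \<and> graded_connected_hopf_algebra H_mult (H_one :: 'k H_dqp) H_comult_pre H_counit H_homogeneous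
     \<and> (\<forall>B \<in> {H_sqp, H_dp, H_tqp :: 'k H_dqp set}.
          hopf_subalgebra H_mult H_one H_comult H_counit B \<and>
          hopf_subalgebra H_mult H_one H_comult_pre H_counit B)
     \<and> hopf_morphism_into
          H_mult (H_one :: 'k H_dqp) H_comult_pre H_counit
          H_mult H_one H_comult H_counit H_dp H_pos
     \<and> range H_pos = (H_dp :: 'k H_dqp set)
     \<and> H_pos \<circ> H_pos = (H_pos :: 'k H_dqp \<Rightarrow> 'k H_dqp)"
proof -
  have sub: "hopf_subalgebra H_mult H_one (H_cut s) H_counit B"
    if "B \<in> {H_sqp, H_dp, H_tqp :: 'k H_dqp set}" for s B
    using that hopf_subalgebra_hereditary[of _ s] hereditary_special hereditary_double_poset
      hereditary_trivial by (auto simp: H_sqp_def H_dp_def H_tqp_def)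
  have antipodes: "\<exists>S. is_antipode H_mult (H_one :: 'k H_dqp) (H_cut s) H_counit S" for s
    by (rule hopf_algebra.antipode_exists[OF hopf_algebra_H_cut])
  have "hopf_morphism_into H_mult (H_one :: 'k H_dqp) (H_cut True) H_counit
      H_mult H_one (H_cut False) H_counit H_dp H_pos"
    unfolding hopf_morphism_into_def
    using hopf_algebra_H_cut sub[of H_dp False] antipodes[of True] antipodes[of False]
    by (simp add: linear_H_pos H_pos_in_dp H_pos_mult H_cut_pos H_counit_pos) (blast intro: H_pos_antipode)
  \<comment> \<open>\<open>H_pos\<close> maps into \<open>H_dp\<close> and fixes it pointwise, which
    also yields idempotence below.\<close>
  moreover have "range H_pos = (H_dp :: 'k H_dqp set)"
    using H_pos_in_dp H_pos_eq_self by (metis image_subset_iff rangeI subsetI subset_antisym)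
  moreover have "H_pos \<circ> H_pos = (H_pos :: 'k H_dqp \<Rightarrow> 'k H_dqp)"
    by (simp add: fun_eq_iff H_pos_eq_self H_pos_in_dp)
  ultimately show ?thesis
    unfolding H_comult_eq_H_cut using graded_connected_H_cut sub by blast
qed

end
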